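(* Let $\beta>0$, $\delta<\tfrac12$ and $\epsilon\in(0,1)$ be constants, and let $R=R(N)$ satisfy $R\le N^{-\beta}$. Then, with probability $1-o(1)$ (as $N\to\infty$) over the random planar network $\mathcal N(N,R)$, every $\delta$-error protocol on $\mathcal N(N,R)$ with $\epsilon$-noise for computing the parity function $\oplus:\{0,1\}^{V(\mathcal N)}\to\{+1,-1\}$ requires $\Omega(N\log\log N)$ transmissions. That is, there is a constant $c>0$ depending only on $\beta,\delta,\epsilon$ such that, with probability $1-o(1)$ over $\mathcal N(N,R)$, every such protocol has cost at least $cN\log\log N$.
   Context: Parity is $\oplus(x)=(-1)^{\sum_v x_v}$; a bit $b\in\{0,1\}$ output by a protocol is identified with $(-1)^b\in\{+1,-1\}$. Communication network: an undirected graph $G$ whose vertices are sensors; a message sent by a sensor is received by all its neighbours (and by nobody else). Noise: in an $\epsilon$-noise network, when sensor $v$ sends bit $b$ in time step $t$, each neighbour $w$ of $v$ receives $b\oplus\eta_{w,t}$, where $\eta_{w,t}$ equals $1$ with probability exactly $\epsilon$ and $0$ with probability $1-\epsilon$; all these noise bits are mutually independent (over neighbours and time steps). Input: an element of $\{0,1\}^{V(G)}$, one bit for each sensor. Protocol: the sensors take turns sending single-bit messages. A protocol of cost $T$ (i.e. with $T$ transmissions) is specified by a fixed sequence of vertices $v_1,\dots,v_T$ (independent of the input) and functions $g_1,\dots,g_T$, $g_t:\{0,1\}^{j_t}\to\{0,1\}$, where $j_t$ is the number of bits possessed by $v_t$ before time step $t$; these bits are its input bit and the noisy copies it received of the bits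 transmitted earlier by its neighbours. In step $t$ the sensor $v_t$ sends the value of $g_t$ on the bits it possesses. The sensor $v_T=v^*$ is a designated sensor, and the value of $g_T$ is the output. Protocols may also use internal randomness. Error: a protocol for $f$ is a $\delta$-error protocol if for every input $x$, $\Pr[\text{output}=f(x)]\ge 1-\delta$, the probability being over the channel noise and the internal randomness (if any) of the protocol. Random planar network $\mathcal N(N,R)$: the random graph with vertex set $\{P_1,\dots,P_N\}$ in which the $P_i$ are placed independently and uniformly at random in $[0,1]^2$ and $P_i,P_j$ ($i\neq j$) are adjacent iff their Euclidean distance is less than $R$. *)

theory Defs
  imports "HOL-Probability.Probability" "HOL-Probability.Product_PMF"
begin

text \<open>
  A network is given by its finite vertex set \<open>V\<close> and its adjacency relation \<open>adj\<close>. Bits are of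
  type \<^typ>\<open>bool\<close>, where \<^const>\<open>True\<close> is 1; exclusive or is then disequality. An element of
  \<open>{0,1}\<^sup>V\<close> is a total function, of which only the values on \<open>V\<close> are ever used.
\<close>

definition bit_sign :: "bool \<Rightarrow> int" where
  "bit_sign b = (-1) ^ of_bool b"

definition parity :: "'v set \<Rightarrow> ('v \<Rightarrow> bool) \<Rightarrow> int" where
  "parity V x = (-1) ^ (\<Sum>v\<in>V. of_bool (x v))"

text \<open>
  Time steps are counted from 0, so that step \<open>t\<close> is made by \<open>senders p ! t\<close>. A choice \<open>g\<close> of
  transmission functions assigns to step \<open>t\<close> the function \<open>g t\<close>; it is only ever applied to lists
  of one fixed length, namely the number of bits that the sender possesses at that step.

  Internal randomness is a random choice of \<open>g\<close>, made before and independently of the channel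
  noise. The joint distribution of the functions \<open>g t\<close> is arbitrary, so private coins of the
  sensors and coins shared by them are both covered; a deterministic protocol is the case of a
  point mass. As only finitely many restrictions of \<open>g\<close> to the relevant lists exist,
  nothing is lost by considering discrete distributions only.
\<close>

record 'v protocol =
  senders :: "'v list"
  rules :: "(nat \<Rightarrow> bool list \<Rightarrow> bool) pmf"

definition cost :: "'v protocol \<Rightarrow> nat" where
  "cost p = length (senders p)"

text \<open>
  The bits possessed by \<open>v\<close> once the bits \<open>h\<close> have been sent by the sensors \<open>vs\<close>, in this order.
  The noise bit for receiver \<open>v\<close> and time step \<open>i\<close> is \<open>\<eta> (v, i)\<close>.
\<close>

definition possessed ::
  "('v \<Rightarrow> 'v \<Rightarrow> bool) \<Rightarrow> 'v list \<Rightarrow> ('v \<Rightarrow> bool) \<Rightarrow> ('v \<times> nat \<Rightarrow> bool) \<Rightarrow> 'v \<Rightarrow> bool list \<Rightarrow> bool list"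
  where
  "possessed adj vs x \<eta> v h =
     x v # map (\<lambda>i. h ! i \<noteq> \<eta> (v, i)) (filter (\<lambda>i. adj (vs ! i) v) [0..<length h])"

primrec sent ::
  "('v \<Rightarrow> 'v \<Rightarrow> bool) \<Rightarrow> 'v list \<Rightarrow> (nat \<Rightarrow> bool list \<Rightarrow> bool) \<Rightarrow> ('v \<Rightarrow> bool) \<Rightarrow> ('v \<times> nat \<Rightarrow> bool)
     \<Rightarrow> nat \<Rightarrow> bool list"
  where
  "sent adj vs g x \<eta> 0 = []"
| "sent adj vs g x \<eta> (Suc t) =
     (let h = sent adj vs g x \<eta> t in h @ [g t (possessed adj vs x \<eta> (vs ! t) h)])"

definition protocol_output ::
  "('v \<Rightarrow> 'v \<Rightarrow> bool) \<Rightarrow> 'v list \<Rightarrow> (nat \<Rightarrow> bool list \<Rightarrow> bool) \<Rightarrow> ('v \<Rightarrow> bool) \<Rightarrow> ('v \<times> nat \<Rightarrow> bool)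
     \<Rightarrow> bool"
  where
  "protocol_output adj vs g x \<eta> = last (sent adj vs g x \<eta> (length vs))"

definition noise :: "'v set \<Rightarrow> nat \<Rightarrow> real \<Rightarrow> ('v \<times> nat \<Rightarrow> bool) pmf" where
  "noise V T \<epsilon> = Pi_pmf (V \<times> {..<T}) False (\<lambda>_. bernoulli_pmf \<epsilon>)"

text \<open>The sequence of senders is nonempty because the last transmission carries the output.\<close>

definition protocol_on :: "'v set \<Rightarrow> 'v protocol \<Rightarrow> bool" where
  "protocol_on V p \<longleftrightarrow> senders p \<noteq> [] \<and> set (senders p) \<subseteq> V"

definition error_protocol ::
  "'v set \<Rightarrow> ('v \<Rightarrow> 'v \<Rightarrow> bool) \<Rightarrow> real \<Rightarrow> real \<Rightarrow> (('v \<Rightarrow> bool) \<Rightarrow> int) \<Rightarrow> 'v protocol \<Rightarrow> bool" where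
  "error_protocol V adj \<epsilon> \<delta> f p \<longleftrightarrow>
     protocol_on V p \<and>
     (\<forall>x. measure_pmf.prob (pair_pmf (rules p) (noise V (cost p) \<epsilon>))
            {(g, \<eta>). bit_sign (protocol_output adj (senders p) g x \<eta>) = f x} \<ge> 1 - \<delta>)"

text \<open>The distance on \<^typ>\<open>real \<times> real\<close> is the Euclidean one.\<close>

definition random_points :: "nat \<Rightarrow> (nat \<Rightarrow> real \<times> real) measure" where
  "random_points N = PiM {1..N} (\<lambda>_. uniform_measure lborel ({0..1} \<times> {0..1}))"

definition planar_adj :: "real \<Rightarrow> (nat \<Rightarrow> real \<times> real) \<Rightarrow> nat \<Rightarrow> nat \<Rightarrow> bool" where
  "planar_adj r P i j \<longleftrightarrow> i \<noteq> j \<and> dist (P i) (P j) < r"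

end

theory Submission
  imports Defs "HOL-Real_Asymp.Real_Asymp"
begin

text \<open>
  Fix the transmission functions and record, for each step, the two bits that the sender would
  send for the two values of its own input bit. The probability of such a transcript on input
  \<open>x\<close> is a product over the sensors \<open>w\<close> of factors depending only on the inputs of the
  neighbours of \<open>w\<close>. Flipping the input of a sensor that sends at most \<open>d\<close> times changes each
  factor by at most the power \<open>M = r\<^sup>d\<close> of the odds \<open>r\<close> of the noise. A level-one inequality for
  product measures, together with the bound \<open>T ln 4\<close> on the entropy of the transcript, shows that
  the relative entropies between the transcripts on \<open>x\<close> and on \<open>x\<close> with one flipped bit
  sum up to \<open>O(M\<^sup>3 T)\<close> over all sensors that send at most \<open>d\<close> times. If the cost \<open>T\<close> is at most
  \<open>c N ln (ln N)\<close>, then most sensors send \<open>O(c ln (ln N))\<close> times, and the average relative entropy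
  is \<open>o(ln N)\<close>.

  As the radius is at most \<open>N\<close> to a negative power, only few pairs of sensors have a common
  neighbour, so there is a set \<open>J\<close> of polynomial size of typical sensors without common
  neighbours. Given the transcript and the inputs outside \<open>J\<close>, the inputs in \<open>J\<close> are independent,
  and each of them is uncertain with probability \<open>exp (- o(ln N))\<close>. Their parity is therefore
  almost unbiased.
\<close>

section \<open>Independent noise bits\<close>

definition noise_exp :: "real \<Rightarrow> 'a set \<Rightarrow> (('a \<Rightarrow> bool) \<Rightarrow> real) \<Rightarrow> real" where
  "noise_exp \<epsilon> A f = measure_pmf.expectation (Pi_pmf A False (\<lambda>_. bernoulli_pmf \<epsilon>)) f"

definition depends_on :: "'a set \<Rightarrow> (('a \<Rightarrow> bool) \<Rightarrow> 'b) \<Rightarrow> bool" where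
  "depends_on S F \<longleftrightarrow> (\<forall>\<eta> \<eta>'. (\<forall>a\<in>S. \<eta> a = \<eta>' a) \<longrightarrow> F \<eta> = F \<eta>')"

text \<open>With finite support every real function of the noise is integrable, so linearity and
  monotonicity of \<open>noise_exp\<close> carry no integrability conditions.\<close>

lemma finite_set_noise:
  assumes "finite A"
  shows "finite (set_pmf (Pi_pmf A False (\<lambda>_. bernoulli_pmf \<epsilon>)))"
  by (rule finite_subset[OF set_Pi_pmf_subset'[OF assms]], rule finite_PiE_dflt)
     (use assms in auto)

context
  fixes A :: "'a set" and \<epsilon> :: real
  assumes fin: "finite A"
begin

lemma noise_exp_add: "noise_exp \<epsilon> A (\<lambda>\<eta>. f \<eta> + g \<eta>) = noise_exp \<epsilon> A f + noise_exp \<epsilon> A g"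
  unfolding noise_exp_def
  by (intro Bochner_Integration.integral_add integrable_measure_pmf_finite finite_set_noise fin)

lemma noise_exp_diff: "noise_exp \<epsilon> A (\<lambda>\<eta>. f \<eta> - g \<eta>) = noise_exp \<epsilon> A f - noise_exp \<epsilon> A g"
  unfolding noise_exp_def
  by (intro Bochner_Integration.integral_diff integrable_measure_pmf_finite finite_set_noise fin)

lemma noise_exp_cmult: "noise_exp \<epsilon> A (\<lambda>\<eta>. c * f \<eta>) = c * noise_exp \<epsilon> A f"
  unfolding noise_exp_def by simp

lemma noise_exp_const: "noise_exp \<epsilon> A (\<lambda>\<eta>. c) = c"
  unfolding noise_exp_def by simp

lemma noise_exp_sum: "noise_exp \<epsilon> A (\<lambda>\<eta>. \<Sum>i\<in>I. f i \<eta>) = (\<Sum>i\<in>I. noise_exp \<epsilon> A (f i))"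
  unfolding noise_exp_def
  by (intro Bochner_Integration.integral_sum integrable_measure_pmf_finite finite_set_noise fin)

lemma noise_exp_mono: "(\<And>\<eta>. f \<eta> \<le> g \<eta>) \<Longrightarrow> noise_exp \<epsilon> A f \<le> noise_exp \<epsilon> A g"
  unfolding noise_exp_def
  by (intro integral_mono integrable_measure_pmf_finite finite_set_noise fin)

text \<open>Conditioning on the coordinate \<open>a\<close>; this is the induction step of the
  arguments over the set of coordinates.\<close>

lemma noise_exp_insert:
  assumes "a \<notin> A" "0 \<le> \<epsilon>" "\<epsilon> \<le> 1"
  shows "noise_exp \<epsilon> (insert a A) f =
    \<epsilon> * noise_exp \<epsilon> A (\<lambda>\<eta>. f (\<eta>(a := True))) + (1 - \<epsilon>) * noise_exp \<epsilon> A (\<lambda>\<eta>. f (\<eta>(a := False)))"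
proof -
  have "noise_exp \<epsilon> (insert a A) f = measure_pmf.expectation (bernoulli_pmf \<epsilon> \<bind>
      (\<lambda>b. map_pmf (\<lambda>h. h(a := b)) (Pi_pmf A False (\<lambda>_. bernoulli_pmf \<epsilon>)))) f"
    unfolding noise_exp_def using assms fin
    by (subst Pi_pmf_insert') (auto simp: map_pmf_def)
  also have "\<dots> = measure_pmf.expectation (bernoulli_pmf \<epsilon>)
      (\<lambda>b. noise_exp \<epsilon> A (\<lambda>\<eta>. f (\<eta>(a := b))))"
    by (subst pmf_expectation_bind[where A = UNIV])
       (use finite_set_noise[OF fin] in \<open>auto simp: noise_exp_def integral_measure_pmf_real[where A = UNIV] mult.commute\<close>)
  also have "\<dots> = \<epsilon> * noise_exp \<epsilon> A (\<lambda>\<eta>. f (\<eta>(a := True))) + (1 - \<epsilon>) * noise_exp \<epsilon> A (\<lambda>\<eta>. f (\<eta>(a := False)))"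
    using assms by (subst integral_measure_pmf_real[where A = UNIV]) (auto simp: UNIV_bool)
  finally show ?thesis .
qed

lemma noise_exp_nonneg: "(\<And>\<eta>. 0 \<le> f \<eta>) \<Longrightarrow> 0 \<le> noise_exp \<epsilon> A f"
  using noise_exp_mono[of "\<lambda>_. 0" f] by (simp add: noise_exp_const)

end

lemma depends_onD_update:
  fixes F :: "('a \<Rightarrow> bool) \<Rightarrow> 'b"
  assumes "depends_on S F"
  shows "depends_on S (\<lambda>\<eta>. F (\<eta>(a := b)))"
  unfolding depends_on_def
proof (intro allI impI)
  fix \<eta> \<eta>' :: "'a \<Rightarrow> bool"
  assume "\<forall>a\<in>S. \<eta> a = \<eta>' a"
  then have "\<forall>c\<in>S. (\<eta>(a := b)) c = (\<eta>'(a := b)) c" by simp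
  then show "F (\<eta>(a := b)) = F (\<eta>'(a := b))"
    using assms unfolding depends_on_def by blast
qed

lemma depends_on_irrelevant_update:
  assumes "depends_on S F" "a \<notin> S"
  shows "F (\<eta>(a := b)) = F \<eta>"
proof -
  have "\<forall>c\<in>S. (\<eta>(a := b)) c = \<eta> c" using assms(2) by auto
  then show ?thesis using assms(1) unfolding depends_on_def by blast
qed

text \<open>Induction over the coordinates. Each coordinate is irrelevant to at least one of
  \<open>F\<close> and \<open>G\<close>, so conditioning on it averages only the other one and the
  product form survives.\<close>

lemma noise_exp_mult_indep:
  assumes "finite A" "0 \<le> \<epsilon>" "\<epsilon> \<le> 1" "S \<inter> S' = {}" "depends_on S F" "depends_on S' G"
  shows "noise_exp \<epsilon> A (\<lambda>\<eta>. F \<eta> * G \<eta>) = noise_exp \<epsilon> A F * noise_exp \<epsilon> A G"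
  using assms(1,4-)
proof (induction A arbitrary: F G rule: finite_induct)
  case empty
  then show ?case by (simp add: noise_exp_def)
next
  case (insert a A)
  note upd = depends_onD_update[OF insert.prems(2)] depends_onD_update[OF insert.prems(3)]
  have IH: "noise_exp \<epsilon> A (\<lambda>\<eta>. F (\<eta>(a := b)) * G (\<eta>(a := c)))
      = noise_exp \<epsilon> A (\<lambda>\<eta>. F (\<eta>(a := b))) * noise_exp \<epsilon> A (\<lambda>\<eta>. G (\<eta>(a := c)))" for b c
    using insert.IH[OF insert.prems(1) upd(1)[of a b] upd(2)[of a c]] .
  note ins = noise_exp_insert[OF insert.hyps assms(2,3)]
  show ?case
  proof (cases "a \<in> S")
    case True
    then have "a \<notin> S'" using insert.prems(1) by blast
    then have G: "noise_exp \<epsilon> A (\<lambda>\<eta>. G (\<eta>(a := b))) = noise_exp \<epsilon> A G" for b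
      by (simp only: depends_on_irrelevant_update[OF insert.prems(3) \<open>a \<notin> S'\<close>])
    show ?thesis unfolding ins IH G by (simp add: algebra_simps)
  next
    case False
    then have F: "noise_exp \<epsilon> A (\<lambda>\<eta>. F (\<eta>(a := b))) = noise_exp \<epsilon> A F" for b
      by (simp only: depends_on_irrelevant_update[OF insert.prems(2) False])
    show ?thesis unfolding ins IH F by (simp add: algebra_simps)
  qed
qed

lemma noise_exp_prod_indep:
  assumes "finite A" "0 \<le> \<epsilon>" "\<epsilon> \<le> 1" "finite K" "disjoint_family_on S K"
    and "\<And>k. k \<in> K \<Longrightarrow> depends_on (S k) (F k)"
  shows "noise_exp \<epsilon> A (\<lambda>\<eta>. \<Prod>k\<in>K. F k \<eta>) = (\<Prod>k\<in>K. noise_exp \<epsilon> A (F k))"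
  using assms(4-)
proof (induction K rule: finite_induct)
  case empty
  then show ?case by (simp add: noise_exp_def)
next
  case (insert k K)
  have dep: "depends_on (\<Union>(S ` K)) (\<lambda>\<eta>. \<Prod>k\<in>K. F k \<eta>)"
    unfolding depends_on_def
    by (intro allI impI prod.cong refl) (use insert.prems(2) in \<open>auto simp: depends_on_def\<close>)
  have "S k \<inter> \<Union>(S ` K) = {}"
    using insert.prems(1) insert.hyps(2) by (auto simp: disjoint_family_on_def)
  from noise_exp_mult_indep[OF assms(1-3) this insert.prems(2)[of k] dep]
  have "noise_exp \<epsilon> A (\<lambda>\<eta>. F k \<eta> * (\<Prod>k\<in>K. F k \<eta>))
      = noise_exp \<epsilon> A (F k) * noise_exp \<epsilon> A (\<lambda>\<eta>. \<Prod>k\<in>K. F k \<eta>)"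
    by simp
  moreover have "disjoint_family_on S K"
    using insert.prems(1) by (auto simp: disjoint_family_on_def)
  ultimately show ?case using insert by simp
qed

section \<open>Change of measure when noise bits are inverted\<close>

definition flip_weight :: "real \<Rightarrow> 'a set \<Rightarrow> ('a \<Rightarrow> bool) \<Rightarrow> real" where
  "flip_weight \<epsilon> D \<eta> = (\<Prod>a\<in>D. if \<eta> a then (1 - \<epsilon>) / \<epsilon> else \<epsilon> / (1 - \<epsilon>))"

text \<open>\<open>flip_weight \<epsilon> D\<close> is the density of the noise with the bits in
  \<open>D\<close> inverted relative to the original noise. Both laws are products, so the density
  is found one coordinate at a time.\<close>

lemma noise_exp_flip:
  assumes "finite A" "0 < \<epsilon>" "\<epsilon> < 1" "D \<subseteq> A"
  shows "noise_exp \<epsilon> A (\<lambda>\<eta>. f (\<lambda>a. \<eta> a \<noteq> (a \<in> D))) = noise_exp \<epsilon> A (\<lambda>\<eta>. f \<eta> * flip_weight \<epsilon> D \<eta>)"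
  using assms(1,4)
proof (induction A arbitrary: D f rule: finite_induct)
  case empty
  then show ?case by (simp add: flip_weight_def)
next
  case (insert a A)
  define D' where "D' = D - {a}"
  have D': "D' \<subseteq> A" "finite D'" "a \<notin> D'"
    using insert.prems insert.hyps by (auto simp: D'_def intro: finite_subset)
  have upd: "(\<lambda>x. (\<eta>(a := b)) x \<noteq> (x \<in> D)) = (\<lambda>x. \<eta> x \<noteq> (x \<in> D'))(a := (b \<noteq> (a \<in> D)))" for \<eta> b
    by (auto simp: D'_def fun_eq_iff)
  note IH = insert.IH[OF D'(1), of "\<lambda>\<eta>. f (\<eta>(a := _))"]
  have w': "flip_weight \<epsilon> D' (\<eta>(a := b)) = flip_weight \<epsilon> D' \<eta>" for \<eta> b
    unfolding flip_weight_def using D' by (intro prod.cong) auto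
  have c0: "0 \<le> \<epsilon>" "\<epsilon> \<le> 1" using assms by auto
  note ins = noise_exp_insert[OF insert.hyps c0]
  note cm = noise_exp_cmult[symmetric]
  show ?case
  proof (cases "a \<in> D")
    case True
    then have "D = insert a D'" by (auto simp: D'_def)
    then have w: "flip_weight \<epsilon> D (\<eta>(a := b)) =
        (if b then (1 - \<epsilon>) / \<epsilon> else \<epsilon> / (1 - \<epsilon>)) * flip_weight \<epsilon> D' \<eta>" for \<eta> b
      using D' w' by (simp add: flip_weight_def)
    have m: "f x * (c * flip_weight \<epsilon> D' y) = c * (f x * flip_weight \<epsilon> D' y)" for x y c by simp
    show ?thesis unfolding ins upd IH w m noise_exp_cmult[OF insert.hyps(1)] using True assms(2,3) by simp
  next
    case False
    then have "D = D'" by (auto simp: D'_def)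
    with w' have w: "flip_weight \<epsilon> D (\<eta>(a := b)) = flip_weight \<epsilon> D' \<eta>" for \<eta> b by simp
    show ?thesis unfolding ins upd IH w using False by simp
  qed
qed

lemma noise_exp_flip_weight:
  assumes "finite A" "0 < \<epsilon>" "\<epsilon> < 1" "D \<subseteq> A"
  shows "noise_exp \<epsilon> A (flip_weight \<epsilon> D) = 1"
  using noise_exp_flip[OF assms, of "\<lambda>_. 1"] by (simp add: noise_exp_const assms)

text \<open>The largest value of a single factor of \<open>flip_weight\<close>. The maximum makes it
  symmetric in \<epsilon> and 1 - \<epsilon>, so noise rates above 1/2 need no separate
  treatment.\<close>

definition odds :: "real \<Rightarrow> real" where
  "odds \<epsilon> = max ((1 - \<epsilon>) / \<epsilon>) (\<epsilon> / (1 - \<epsilon>))"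

lemma odds_ge_1:
  assumes "0 < \<epsilon>" "\<epsilon> < 1"
  shows "1 \<le> odds \<epsilon>"
  using assms by (cases "\<epsilon> \<le> 1/2") (auto simp: odds_def le_max_iff_disj field_simps)

lemma flip_weight_pos:
  assumes "0 < \<epsilon>" "\<epsilon> < 1"
  shows "0 < flip_weight \<epsilon> D \<eta>"
  unfolding flip_weight_def using assms by (intro prod_pos) auto

lemma flip_weight_le:
  assumes "0 < \<epsilon>" "\<epsilon> < 1"
  shows "flip_weight \<epsilon> D \<eta> \<le> odds \<epsilon> ^ card D"
proof -
  have "(\<Prod>a\<in>D. if \<eta> a then (1 - \<epsilon>) / \<epsilon> else \<epsilon> / (1 - \<epsilon>)) \<le> (\<Prod>a\<in>D. odds \<epsilon>)"
    using assms by (intro prod_mono) (auto simp: odds_def)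
  then show ?thesis by (simp add: flip_weight_def)
qed

section \<open>The level-one inequality\<close>

lemma exp_le_quadratic:
  fixes u :: real
  assumes "u \<le> 1"
  shows "exp u \<le> 1 + u + u\<^sup>2"
proof (cases "0 \<le> u")
  case True
  then show ?thesis using exp_bound assms by blast
next
  case False
  \<comment> \<open>For negative u, \<open>exp u * (1 - u)\<close> is at most 1, whereas (1 + u +
    u^2) (1 - u) = 1 - u^3 is at least 1.\<close>
  have "exp u * (1 - u) \<le> exp u * exp (- u)"
    using exp_ge_add_one_self[of "- u"] by (intro mult_left_mono) auto
  also have "\<dots> = 1" by (simp flip: exp_add)
  also have "1 \<le> 1 + (- u) * u\<^sup>2" using False by (simp add: mult_nonpos_nonneg)
  also have "\<dots> = (1 + u + u\<^sup>2) * (1 - u)"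
    by (simp add: algebra_simps power2_eq_square)
  finally show ?thesis using False by simp
qed

text \<open>Gibbs' variational bound applied to the test function \<open>\<theta> * (\<Sum>i\<in>I. s i * (flip_weight \<epsilon> (D i) - 1))\<close>.\<close>

lemma level_one_inequality:
  assumes fin: "finite A" "finite I" and M: "1 \<le> M" and \<epsilon>: "0 < \<epsilon>" "\<epsilon> < 1"
    and D: "disjoint_family_on D I" "\<And>i. i \<in> I \<Longrightarrow> D i \<subseteq> A"
    and LM: "\<And>i \<eta>. i \<in> I \<Longrightarrow> flip_weight \<epsilon> (D i) \<eta> \<le> M"
    and b: "b = noise_exp \<epsilon> A (\<lambda>\<eta>. of_bool (B \<eta>))" "0 < b"
    and s: "\<And>i. i \<in> I \<Longrightarrow> s i = noise_exp \<epsilon> A (\<lambda>\<eta>. of_bool (B \<eta>) * flip_weight \<epsilon> (D i) \<eta>) / b - 1"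
  shows "(\<Sum>i\<in>I. (s i)\<^sup>2) \<le> 4 * M\<^sup>2 * ln (1 / b)"
proof -
  \<comment> \<open>This value minimises \<theta>^2 M^2 - \<theta>, which becomes -1 / (4 M^2). It
    also keeps the exponents below within [-1/2, 1/2], where the quadratic bound on
    \<open>exp\<close> applies.\<close>
  define \<theta> where "\<theta> = 1 / (2 * M\<^sup>2)"
  define L where "L i = flip_weight \<epsilon> (D i)" for i
  define S where "S = (\<Sum>i\<in>I. (s i)\<^sup>2)"
  define g where "g \<eta> = (\<Sum>i\<in>I. \<theta> * s i * (L i \<eta> - 1))" for \<eta>
  have \<theta>: "\<theta> > 0" using M by (simp add: \<theta>_def)
  have Lpos: "0 < L i \<eta>" for i \<eta> using \<epsilon> by (simp add: L_def flip_weight_pos)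
  have Labs: "\<bar>L i \<eta> - 1\<bar> \<le> M" if "i \<in> I" for i \<eta>
    using Lpos[of i \<eta>] LM[OF that, of \<eta>] M by (simp add: L_def abs_le_iff)
  \<comment> \<open>Given \<open>B\<close>, the mean of the weight lies between 0 and
    \<open>M\<close>; \<open>s i\<close> is this mean minus 1.\<close>
  have sM: "\<bar>s i\<bar> \<le> M" if "i \<in> I" for i
  proof -
    have "noise_exp \<epsilon> A (\<lambda>\<eta>. of_bool (B \<eta>) * L i \<eta>) \<le> noise_exp \<epsilon> A (\<lambda>\<eta>. M * of_bool (B \<eta>))"
      using LM[OF that] by (intro noise_exp_mono fin) (auto simp: L_def)
    then have "noise_exp \<epsilon> A (\<lambda>\<eta>. of_bool (B \<eta>) * L i \<eta>) / b \<le> M"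
      using b by (simp add: noise_exp_cmult fin field_simps)
    moreover have "0 \<le> noise_exp \<epsilon> A (\<lambda>\<eta>. of_bool (B \<eta>) * L i \<eta>) / b"
      using b Lpos by (intro divide_nonneg_pos noise_exp_nonneg fin) (auto simp: less_imp_le)
    ultimately show ?thesis using M s[OF that] by (simp add: L_def abs_le_iff)
  qed
  \<comment> \<open>\<open>s i\<close> is the conditional mean of \<open>L i \<eta> - 1\<close>
    given \<open>B\<close>, so the conditional mean of \<open>g\<close> is
    \<open>\<theta> * S\<close>.\<close>
  have mean: "noise_exp \<epsilon> A (\<lambda>\<eta>. of_bool (B \<eta>) * g \<eta>) = \<theta> * S * b"
  proof -
    have "noise_exp \<epsilon> A (\<lambda>\<eta>. of_bool (B \<eta>) * g \<eta>) =
      noise_exp \<epsilon> A (\<lambda>\<eta>. \<Sum>i\<in>I. (\<theta> * s i) * (of_bool (B \<eta>) * L i \<eta> - of_bool (B \<eta>)))"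
      by (simp add: g_def sum_distrib_left algebra_simps)
    also have "\<dots> = (\<Sum>i\<in>I. (\<theta> * s i) * (s i * b))"
      unfolding noise_exp_sum[OF fin(1)] noise_exp_cmult[OF fin(1)] noise_exp_diff[OF fin(1)]
    proof (intro sum.cong refl)
      fix i assume "i \<in> I"
      then have "noise_exp \<epsilon> A (\<lambda>\<eta>. of_bool (B \<eta>) * L i \<eta>) = (s i + 1) * b"
        using b(2) s by (simp add: L_def)
      then show "\<theta> * s i * (noise_exp \<epsilon> A (\<lambda>\<eta>. of_bool (B \<eta>) * L i \<eta>) -
          noise_exp \<epsilon> A (\<lambda>\<eta>. of_bool (B \<eta>))) = \<theta> * s i * (s i * b)"
        unfolding b(1)[symmetric] by (simp add: algebra_simps)
    qed
    finally show ?thesis by (simp add: S_def sum_distrib_left sum_distrib_right power2_eq_square mult_ac)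
  qed
  have gibbs: "exp (\<theta> * S) * b \<le> noise_exp \<epsilon> A (\<lambda>\<eta>. exp (g \<eta>))"
  proof -
    define a where "a = \<theta> * S"
    \<comment> \<open>On \<open>B\<close> this is the tangent of \<open>exp\<close> at the
      conditional mean \<open>a\<close> of \<open>g\<close>; off \<open>B\<close> the left side is
      0. Taking expectations gives Jensen's inequality conditioned on \<open>B\<close>.\<close>
    have *: "exp a * ((1 - a) * of_bool (B \<eta>) + of_bool (B \<eta>) * g \<eta>) \<le> exp (g \<eta>)" for \<eta>
    proof (cases "B \<eta>")
      case True
      have "exp a * (1 + (g \<eta> - a)) \<le> exp a * exp (g \<eta> - a)"
        using exp_ge_add_one_self[of "g \<eta> - a"] by (intro mult_left_mono) auto
      also have "\<dots> = exp (g \<eta>)" by (simp flip: exp_add)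
      finally show ?thesis using True by (simp add: algebra_simps)
    qed simp
    have "noise_exp \<epsilon> A (\<lambda>\<eta>. exp a * ((1 - a) * of_bool (B \<eta>) + of_bool (B \<eta>) * g \<eta>))
        \<le> noise_exp \<epsilon> A (\<lambda>\<eta>. exp (g \<eta>))"
      by (intro noise_exp_mono fin *)
    then have "exp a * ((1 - a) * b + a * b) \<le> noise_exp \<epsilon> A (\<lambda>\<eta>. exp (g \<eta>))"
      unfolding noise_exp_cmult[OF fin(1)] noise_exp_add[OF fin(1)] mean b(1)[symmetric] a_def .
    then show ?thesis by (simp add: a_def algebra_simps)
  qed
  \<comment> \<open>Since \<open>L i\<close> has mean 1, the linear term of the exponential vanishes
    and only the second-order term remains.\<close>
  have mgf: "noise_exp \<epsilon> A (\<lambda>\<eta>. exp (\<theta> * s i * (L i \<eta> - 1))) \<le> exp (\<theta>\<^sup>2 * (s i)\<^sup>2 * M\<^sup>2)"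
    if i: "i \<in> I" for i
  proof -
    have *: "exp (\<theta> * s i * (L i \<eta> - 1)) \<le> (1 + \<theta>\<^sup>2 * (s i)\<^sup>2 * M\<^sup>2) + \<theta> * s i * (L i \<eta> - 1)" for \<eta>
    proof -
      define u where "u = \<theta> * s i * (L i \<eta> - 1)"
      have "\<bar>s i\<bar> * \<bar>L i \<eta> - 1\<bar> \<le> M * M"
        using sM[OF i] Labs[OF i] by (intro mult_mono) auto
      then have "\<theta> * (\<bar>s i\<bar> * \<bar>L i \<eta> - 1\<bar>) \<le> \<theta> * (M * M)"
        using \<theta> by (intro mult_left_mono) auto
      also have "\<dots> = 1 / 2" using M by (simp add: \<theta>_def power2_eq_square)
      finally have "\<bar>u\<bar> \<le> 1 / 2" using \<theta> by (simp add: u_def abs_mult)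
      then have "u \<le> 1" by linarith
      from exp_le_quadratic[OF this] have "exp u \<le> 1 + u + u\<^sup>2" .
      also have "u\<^sup>2 \<le> \<theta>\<^sup>2 * (s i)\<^sup>2 * M\<^sup>2"
      proof -
        have "(L i \<eta> - 1)\<^sup>2 \<le> M\<^sup>2" using Labs[OF i] M by (intro abs_le_square_iff[THEN iffD1]) simp
        then show ?thesis unfolding u_def power_mult_distrib by (intro mult_left_mono) auto
      qed
      finally show ?thesis by (simp add: u_def)
    qed
    have "noise_exp \<epsilon> A (\<lambda>\<eta>. exp (\<theta> * s i * (L i \<eta> - 1)))
        \<le> noise_exp \<epsilon> A (\<lambda>\<eta>. (1 + \<theta>\<^sup>2 * (s i)\<^sup>2 * M\<^sup>2) + \<theta> * s i * (L i \<eta> - 1))"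
      by (intro noise_exp_mono fin *)
    also have "\<dots> = 1 + \<theta>\<^sup>2 * (s i)\<^sup>2 * M\<^sup>2"
      using noise_exp_flip_weight[OF fin(1) \<epsilon> D(2)[OF i]] fin
      by (simp add: noise_exp_add noise_exp_cmult noise_exp_diff noise_exp_const L_def)
    also have "\<dots> \<le> exp (\<theta>\<^sup>2 * (s i)\<^sup>2 * M\<^sup>2)" by simp
    finally show ?thesis .
  qed
  have "noise_exp \<epsilon> A (\<lambda>\<eta>. exp (g \<eta>)) = noise_exp \<epsilon> A (\<lambda>\<eta>. \<Prod>i\<in>I. exp (\<theta> * s i * (L i \<eta> - 1)))"
    by (simp add: g_def exp_sum fin)
  also have "\<dots> = (\<Prod>i\<in>I. noise_exp \<epsilon> A (\<lambda>\<eta>. exp (\<theta> * s i * (L i \<eta> - 1))))"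
  proof (rule noise_exp_prod_indep[OF fin(1) _ _ fin(2) D(1)])
    fix i assume "i \<in> I"
    have "L i \<eta> = L i \<eta>'" if "\<forall>a\<in>D i. \<eta> a = \<eta>' a" for \<eta> \<eta>'
      unfolding L_def flip_weight_def using that by (intro prod.cong) auto
    then show "depends_on (D i) (\<lambda>\<eta>. exp (\<theta> * s i * (L i \<eta> - 1)))"
      unfolding depends_on_def by metis
  qed (use \<epsilon> in auto)
  also have "\<dots> \<le> (\<Prod>i\<in>I. exp (\<theta>\<^sup>2 * (s i)\<^sup>2 * M\<^sup>2))"
    by (intro prod_mono conjI mgf noise_exp_nonneg fin) auto
  also have "\<dots> = exp (\<theta>\<^sup>2 * M\<^sup>2 * S)"
    by (simp add: S_def exp_sum[symmetric] fin sum_distrib_left mult_ac)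
  finally have "exp (\<theta> * S) * b \<le> exp (\<theta>\<^sup>2 * M\<^sup>2 * S)" using gibbs by linarith
  then have "b \<le> exp (\<theta>\<^sup>2 * M\<^sup>2 * S - \<theta> * S)"
    by (simp add: exp_diff field_simps)
  then have "ln b \<le> \<theta>\<^sup>2 * M\<^sup>2 * S - \<theta> * S"
    using b(2) by (metis ln_exp ln_le_cancel_iff exp_gt_zero)
  moreover have "\<theta>\<^sup>2 * M\<^sup>2 * S - \<theta> * S = - S / (4 * M\<^sup>2)"
    using M by (simp add: \<theta>_def field_simps power2_eq_square)
  ultimately have "S / (4 * M\<^sup>2) \<le> ln (1 / b)" using b(2) by (simp add: ln_div)
  then show ?thesis using M by (simp add: S_def field_simps)
qed

section \<open>Transcripts of a protocol with fixed rules\<close>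

definition chosen :: "bool \<times> bool \<Rightarrow> bool \<Rightarrow> bool" where
  "chosen p b = (if b then snd p else fst p)"

text \<open>The noisy part of \<open>possessed\<close>, with the sent bits read off the transcript:
  the sender's own input selects which of the two recorded bits was sent.\<close>

definition received ::
  "('v \<Rightarrow> 'v \<Rightarrow> bool) \<Rightarrow> 'v list \<Rightarrow> (bool \<times> bool) list \<Rightarrow> ('v \<Rightarrow> bool) \<Rightarrow> ('v \<times> nat \<Rightarrow> bool) \<Rightarrow> 'v \<Rightarrow> nat \<Rightarrow> bool list"
  where
  "received adj vs H x \<eta> w t =
     map (\<lambda>i. chosen (H ! i) (x (vs ! i)) \<noteq> \<eta> (w, i)) (filter (\<lambda>i. adj (vs ! i) w) [0..<t])"

lemma depends_on_comp:
  fixes F :: "('a \<Rightarrow> bool) \<Rightarrow> 'b"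
  assumes "depends_on S F"
  shows "depends_on S (\<lambda>\<eta>. h (F \<eta>))"
  unfolding depends_on_def
proof (intro allI impI arg_cong[of _ _ h])
  fix \<eta> \<eta>' :: "'a \<Rightarrow> bool" assume "\<forall>a\<in>S. \<eta> a = \<eta>' a"
  then show "F \<eta> = F \<eta>'" using assms unfolding depends_on_def by blast
qed

text \<open>Every entry is determined by the entries before it. This yields exactly one transcript
  for each outcome of the noise.\<close>

lemma ex1_recursive_list:
  "\<exists>!H. length H = n \<and> (\<forall>t<n. H ! t = F t (take t H))"
proof (induction n)
  case 0
  then show ?case by auto
next
  case (Suc n)
  then obtain H where H: "length H = n" "\<forall>t<n. H ! t = F t (take t H)"
    and uniq: "\<And>H'. length H' = n \<Longrightarrow> \<forall>t<n. H' ! t = F t (take t H') \<Longrightarrow> H' = H" by metis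
  show ?case
  proof (rule ex1I[of _ "H @ [F n H]"])
    show "length (H @ [F n H]) = Suc n \<and>
        (\<forall>t<Suc n. (H @ [F n H]) ! t = F t (take t (H @ [F n H])))"
      using H by (auto simp: nth_append less_Suc_eq)
    fix H' assume H': "length H' = Suc n \<and> (\<forall>t<Suc n. H' ! t = F t (take t H'))"
    have "take n H' = H"
      using H' by (intro uniq) (auto simp: min_def)
    moreover have "H' = take n H' @ [H' ! n]"
      using H' take_Suc_conv_app_nth[of n H'] by simp
    ultimately show "H' = H @ [F n H]" using H' by (metis lessI)
  qed
qed

text \<open>The transmission functions \<open>g\<close> are deterministic here; internal randomness
  is averaged out in \<open>error_protocol_bound\<close>.\<close>

locale fixed_rules =
  fixes V :: "'v set" and adj :: "'v \<Rightarrow> 'v \<Rightarrow> bool" and vs :: "'v list"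
    and g :: "nat \<Rightarrow> bool list \<Rightarrow> bool" and \<epsilon> :: real
  assumes finite_V: "finite V" and senders_V: "set vs \<subseteq> V" and \<epsilon>: "0 < \<epsilon>" "\<epsilon> < 1"
begin

abbreviation T :: nat where "T \<equiv> length vs"

abbreviation sites :: "('v \<times> nat) set" where "sites \<equiv> V \<times> {..<T}"

definition transcripts :: "(bool \<times> bool) list set" where
  "transcripts = {H. length H = T}"

text \<open>
  A transcript records for each step the two bits that the sender would send for the two values
  of its own input bit. Given the transcript, the behaviour of \<open>w\<close> thus depends on the input only
  through the noisy bits received by \<open>w\<close>, and not through the input bit of \<open>w\<close>.
\<close>

definition agrees :: "(bool \<times> bool) list \<Rightarrow> ('v \<Rightarrow> bool) \<Rightarrow> 'v \<Rightarrow> ('v \<times> nat \<Rightarrow> bool) \<Rightarrow> bool" where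
  "agrees H x w \<eta> \<longleftrightarrow> (\<forall>t<T. vs ! t = w \<longrightarrow>
     H ! t = (g t (False # received adj vs H x \<eta> w t), g t (True # received adj vs H x \<eta> w t)))"

definition factor :: "(bool \<times> bool) list \<Rightarrow> 'v \<Rightarrow> ('v \<Rightarrow> bool) \<Rightarrow> real" where
  "factor H w x = noise_exp \<epsilon> sites (\<lambda>\<eta>. of_bool (agrees H x w \<eta>))"

text \<open>By \<open>prod_factor_eq\<close> this is the probability that the transcript is
  \<open>H\<close> on input \<open>x\<close>; the product reflects the independence of the noise at
  different receivers.\<close>

definition likelihood :: "(bool \<times> bool) list \<Rightarrow> ('v \<Rightarrow> bool) \<Rightarrow> real" where
  "likelihood H x = (\<Prod>w\<in>V. factor H w x)"

lemma sender_in_V: "t < T \<Longrightarrow> vs ! t \<in> V"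
  using senders_V by auto

lemma finite_sites: "finite sites"
  using finite_V by simp

lemma finite_transcripts: "finite transcripts"
  using finite_lists_length_eq[of "UNIV :: (bool \<times> bool) set" T] by (simp add: transcripts_def)

lemma card_transcripts: "card transcripts = 4 ^ T"
  using card_lists_length_eq[of "UNIV :: (bool \<times> bool) set" T]
  by (simp add: transcripts_def card_prod)

lemma agrees_depends: "depends_on ({w} \<times> {..<T}) (agrees H x w)"
  unfolding depends_on_def
proof (intro allI impI)
  fix \<eta> \<eta>' :: "'v \<times> nat \<Rightarrow> bool"
  assume "\<forall>a\<in>{w} \<times> {..<T}. \<eta> a = \<eta>' a"
  then have "received adj vs H x \<eta> w t = received adj vs H x \<eta>' w t" if "t < T" for t
    using that by (auto simp: received_def)
  then show "agrees H x w \<eta> = agrees H x w \<eta>'" by (auto simp: agrees_def)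
qed

lemma factor_cong:
  assumes "\<And>v. v \<in> V \<Longrightarrow> adj v w \<Longrightarrow> x v = x' v"
  shows "factor H w x = factor H w x'"
proof -
  have "received adj vs H x \<eta> w t = received adj vs H x' \<eta> w t" if "t < T" for t \<eta>
    using that assms senders_V nth_mem[of _ vs] by (force simp: received_def)
  then have "agrees H x w \<eta> = agrees H x' w \<eta>" for \<eta> by (auto simp: agrees_def)
  then show ?thesis by (simp add: factor_def)
qed

text \<open>The sites of receiver \<open>w\<close> at which replacing \<open>x\<close> by
  \<open>x'\<close> inverts the bit sent under the transcript \<open>H\<close>.\<close>

definition flipped :: "(bool \<times> bool) list \<Rightarrow> ('v \<Rightarrow> bool) \<Rightarrow> ('v \<Rightarrow> bool) \<Rightarrow> 'v \<Rightarrow> ('v \<times> nat) set" where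
  "flipped H x x' w = {w} \<times> {t. t < T \<and> chosen (H ! t) (x (vs ! t)) \<noteq> chosen (H ! t) (x' (vs ! t))}"

text \<open>For a receiver, an inverted message with unchanged noise looks like an unchanged message
  with inverted noise. A change of input thus becomes a change of the noise measure.\<close>

lemma agrees_flip: "agrees H x' w \<eta> = agrees H x w (\<lambda>a. \<eta> a \<noteq> (a \<in> flipped H x x' w))"
proof -
  have "received adj vs H x' \<eta> w t = received adj vs H x (\<lambda>a. \<eta> a \<noteq> (a \<in> flipped H x x' w)) w t"
    if "t < T" for t
    using that by (auto simp: received_def flipped_def)
  then show ?thesis by (auto simp: agrees_def)
qed

lemma flipped_subset: "w \<in> V \<Longrightarrow> flipped H x x' w \<subseteq> sites"
  by (auto simp: flipped_def)

lemma factor_flip: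
  assumes "w \<in> V"
  shows "factor H w x' = noise_exp \<epsilon> sites
    (\<lambda>\<eta>. of_bool (agrees H x w \<eta>) * flip_weight \<epsilon> (flipped H x x' w) \<eta>)"
  unfolding factor_def agrees_flip[of H x' w _ x]
  by (rule noise_exp_flip[OF finite_sites \<epsilon> flipped_subset[OF assms]])

lemma factor_nonneg: "0 \<le> factor H w x"
  unfolding factor_def by (intro noise_exp_nonneg finite_sites) auto

lemma factor_ratio:
  assumes "w \<in> V" "card (flipped H x x' w) \<le> d"
  shows "factor H w x' \<le> odds \<epsilon> ^ d * factor H w x" "factor H w x \<le> odds \<epsilon> ^ d * factor H w x'"
proof -
  have r: "odds \<epsilon> ^ card (flipped H x x' w) \<le> odds \<epsilon> ^ d"
    using assms(2) odds_ge_1[OF \<epsilon>] by (intro power_increasing)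
  \<comment> \<open>The flipped set is symmetric in the two inputs, so this one bound serves both
    directions.\<close>
  have *: "factor H w z' \<le> odds \<epsilon> ^ d * factor H w z"
    if "flipped H z z' w = flipped H x x' w" for z z'
  proof -
    have "factor H w z' \<le> noise_exp \<epsilon> sites (\<lambda>\<eta>. odds \<epsilon> ^ d * of_bool (agrees H z w \<eta>))"
      unfolding factor_flip[OF assms(1), of H z' z] that
      using flip_weight_le[OF \<epsilon>] r
      by (intro noise_exp_mono finite_sites) (auto intro: order_trans)
    then show ?thesis by (simp add: noise_exp_cmult[OF finite_sites] factor_def)
  qed
  show "factor H w x' \<le> odds \<epsilon> ^ d * factor H w x" by (rule *) simp
  show "factor H w x \<le> odds \<epsilon> ^ d * factor H w x'"
    by (rule *) (auto simp: flipped_def)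
qed

text \<open>Every noise pattern on the finitely many sites has positive probability, so whether a
  factor vanishes does not depend on the input. Ratios and logarithms of factors are therefore
  meaningful as soon as one likelihood is positive.\<close>

lemma factor_pos_iff:
  assumes "w \<in> V"
  shows "0 < factor H w x \<longleftrightarrow> 0 < factor H w x'"
proof -
  have "0 < factor H w z'" if "0 < factor H w z" for z z'
    using factor_ratio(2)[OF assms order_refl, of H z z'] factor_nonneg[of H w z'] that
    by (cases "factor H w z' = 0") auto
  then show ?thesis by blast
qed

section \<open>Likelihoods as probabilities of transcripts\<close>

lemma likelihood_nonneg: "0 \<le> likelihood H x"
  unfolding likelihood_def by (intro prod_nonneg factor_nonneg)

text \<open>The entry of step t is computed by its sender from the noise and the earlier entries.
  Every sensor \<open>w\<close> may perceive an input \<open>\<xi> w\<close> of its own; such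
  hybrids are needed in \<open>expected_factor_ratio\<close>.\<close>

lemma ex1_transcript: "\<exists>!H. H \<in> transcripts \<and> (\<forall>w\<in>V. agrees H (\<xi> w) w \<eta>)"
proof -
  define F where "F t H = (let r = received adj vs H (\<xi> (vs ! t)) \<eta> (vs ! t) t in
    (g t (False # r), g t (True # r)))" for t H
  have take: "received adj vs (take t H) x \<eta> w t = received adj vs H x \<eta> w t" for t H x w
    by (auto simp: received_def)
  have "(\<forall>w\<in>V. agrees H (\<xi> w) w \<eta>) \<longleftrightarrow> (\<forall>t<T. H ! t = F t (take t H))" for H
    unfolding agrees_def F_def Let_def take using sender_in_V by blast
  then show ?thesis
    using ex1_recursive_list[of T F] by (simp add: transcripts_def)
qed

text \<open>Different receivers use disjoint sets of noise bits, so the events whose probabilities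
  are the factors are independent.\<close>

lemma prod_factor_eq:
  "(\<Prod>w\<in>V. factor H w (\<xi> w)) = noise_exp \<epsilon> sites (\<lambda>\<eta>. of_bool (\<forall>w\<in>V. agrees H (\<xi> w) w \<eta>))"
proof -
  have dep: "depends_on ({w} \<times> {..<T}) (\<lambda>\<eta>. of_bool (agrees H (\<xi> w) w \<eta>) :: real)" for w
    by (rule depends_on_comp[OF agrees_depends])
  have "(\<Prod>w\<in>V. factor H w (\<xi> w)) = noise_exp \<epsilon> sites (\<lambda>\<eta>. \<Prod>w\<in>V. of_bool (agrees H (\<xi> w) w \<eta>))"
    unfolding factor_def
    by (rule noise_exp_prod_indep[symmetric, where S = "\<lambda>w. {w} \<times> {..<T}"])
       (use finite_V \<epsilon> dep in \<open>auto simp: disjoint_family_on_def\<close>)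
  also have "(\<lambda>\<eta>. \<Prod>w\<in>V. of_bool (agrees H (\<xi> w) w \<eta>)) =
      (\<lambda>\<eta>. of_bool (\<forall>w\<in>V. agrees H (\<xi> w) w \<eta>) :: real)"
    using finite_V by (auto simp: fun_eq_iff)
  finally show ?thesis .
qed

text \<open>For each noise outcome exactly one transcript agrees, and it contributes the value of
  \<open>f\<close>. Averaging over the noise turns the agreement indicators into products of
  factors.\<close>

lemma sum_transcripts_noise_exp:
  assumes "\<And>H \<eta>. H \<in> transcripts \<Longrightarrow> \<forall>w\<in>V. agrees H (\<xi> w) w \<eta> \<Longrightarrow> f \<eta> = h H"
  shows "(\<Sum>H\<in>transcripts. (\<Prod>w\<in>V. factor H w (\<xi> w)) * h H) = noise_exp \<epsilon> sites f"
proof -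
  have "(\<Sum>H\<in>transcripts. of_bool (\<forall>w\<in>V. agrees H (\<xi> w) w \<eta>) * h H) = f \<eta>" for \<eta>
  proof -
    obtain H0 where H0: "H0 \<in> transcripts" "\<forall>w\<in>V. agrees H0 (\<xi> w) w \<eta>"
      and uniq: "\<And>H. H \<in> transcripts \<Longrightarrow> \<forall>w\<in>V. agrees H (\<xi> w) w \<eta> \<Longrightarrow> H = H0"
      using ex1_transcript[of \<xi> \<eta>] by blast
    have "(\<Sum>H\<in>transcripts. of_bool (\<forall>w\<in>V. agrees H (\<xi> w) w \<eta>) * h H) =
        (\<Sum>H\<in>transcripts. if H = H0 then h H0 else 0)"
    proof (intro sum.cong refl)
      fix H assume "H \<in> transcripts"
      then have "(\<forall>w\<in>V. agrees H (\<xi> w) w \<eta>) \<longleftrightarrow> H = H0" using H0 uniq by blast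
      then show "of_bool (\<forall>w\<in>V. agrees H (\<xi> w) w \<eta>) * h H = (if H = H0 then h H0 else 0)"
        by simp
    qed
    also have "\<dots> = h H0" using H0(1) finite_transcripts by simp
    finally show ?thesis using assms[OF H0] by simp
  qed
  then have "noise_exp \<epsilon> sites f = noise_exp \<epsilon> sites
      (\<lambda>\<eta>. \<Sum>H\<in>transcripts. h H * of_bool (\<forall>w\<in>V. agrees H (\<xi> w) w \<eta>))"
    by (simp add: mult.commute)
  also have "\<dots> = (\<Sum>H\<in>transcripts. h H * (\<Prod>w\<in>V. factor H w (\<xi> w)))"
    unfolding prod_factor_eq noise_exp_sum[OF finite_sites] noise_exp_cmult[OF finite_sites] ..
  finally show ?thesis by (simp add: mult.commute)
qed

lemma sum_transcripts: "(\<Sum>H\<in>transcripts. \<Prod>w\<in>V. factor H w (\<xi> w)) = 1"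
  using sum_transcripts_noise_exp[of \<xi> "\<lambda>_. 1" "\<lambda>_. 1"]
  by (simp add: noise_exp_const[OF finite_sites])

lemma sum_likelihood: "(\<Sum>H\<in>transcripts. likelihood H x) = 1"
  unfolding likelihood_def by (rule sum_transcripts)

lemma sent_eq:
  assumes "H \<in> transcripts" "\<forall>w\<in>V. agrees H x w \<eta>" "t \<le> T"
  shows "sent adj vs g x \<eta> t = map (\<lambda>i. chosen (H ! i) (x (vs ! i))) [0..<t]"
  using assms(3)
proof (induction t)
  case (Suc t)
  define h where "h = map (\<lambda>i. chosen (H ! i) (x (vs ! i))) [0..<t]"
  have p: "possessed adj vs x \<eta> (vs ! t) h = x (vs ! t) # received adj vs H x \<eta> (vs ! t) t"
    by (auto simp: possessed_def received_def h_def)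
  have "H ! t = (g t (False # received adj vs H x \<eta> (vs ! t) t), g t (True # received adj vs H x \<eta> (vs ! t) t))"
    using assms(2) Suc.prems sender_in_V[of t] unfolding agrees_def by (metis Suc_le_eq)
  then have "g t (possessed adj vs x \<eta> (vs ! t) h) = chosen (H ! t) (x (vs ! t))"
    unfolding p by (cases "x (vs ! t)") (simp_all add: chosen_def)
  then show ?case using Suc by (simp add: h_def)
qed simp

text \<open>Given the transcript, the output depends on the input only through the bit of the last
  sender. This is why that sensor is later kept out of \<open>J\<close>.\<close>

lemma protocol_output_eq:
  assumes "H \<in> transcripts" "\<forall>w\<in>V. agrees H x w \<eta>" "vs \<noteq> []"
  shows "protocol_output adj vs g x \<eta> = chosen (last H) (x (last vs))"
proof -
  have "H \<noteq> []" "length H = T" using assms by (auto simp: transcripts_def)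
  then show ?thesis using assms(3)
    unfolding protocol_output_def sent_eq[OF assms(1,2) order_refl]
    by (simp add: last_map last_conv_nth)
qed

end

section \<open>Likelihood ratios under the flip of one input bit\<close>

text \<open>Relative entropy to the uniform distribution is nonnegative: apply
  \<open>ln z \<le> z - 1\<close> at z = 1 / (p i * n), term by term.\<close>

lemma entropy_le_ln_card:
  fixes p :: "'a \<Rightarrow> real"
  assumes "finite S" "S \<noteq> {}" "\<And>i. i \<in> S \<Longrightarrow> 0 \<le> p i" "sum p S = 1"
  shows "(\<Sum>i\<in>S. p i * ln (1 / p i)) \<le> ln (card S)"
proof -
  define n where "n = real (card S)"
  have n: "n > 0" using assms by (auto simp: n_def card_gt_0_iff)
  have "p i * ln (1 / p i) \<le> p i * ln n + (1 / n - p i)" if "i \<in> S" for i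
  proof (cases "p i = 0")
    case False
    then have p: "p i > 0" using assms(3)[OF that] by simp
    have "ln (1 / (p i * n)) \<le> 1 / (p i * n) - 1"
      using p n by (intro ln_le_minus_one) simp
    then have "p i * ln (1 / (p i * n)) \<le> p i * (1 / (p i * n) - 1)"
      using p by (intro mult_left_mono) auto
    moreover have "ln (1 / (p i * n)) = ln (1 / p i) - ln n"
      using p n by (simp add: ln_div ln_mult)
    moreover have "p i * (1 / (p i * n) - 1) = 1 / n - p i"
      using p n by (simp add: right_diff_distrib)
    ultimately have "p i * (ln (1 / p i) - ln n) \<le> 1 / n - p i" by simp
    then show ?thesis by (simp add: right_diff_distrib)
  qed (use n in simp)
  then have "(\<Sum>i\<in>S. p i * ln (1 / p i)) \<le> (\<Sum>i\<in>S. p i * ln n + (1 / n - p i))"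
    by (rule sum_mono)
  also have "\<dots> = ln n"
    using n by (simp add: sum.distrib sum_subtractf assms(4) flip: sum_distrib_right) (simp add: n_def)
  finally show ?thesis by (simp add: n_def)
qed

text \<open>From \<open>ln z \<le> z - 1\<close> at z = 1 / (1 + s) the error term is s^2 / (1 + s);
  the lower bound on 1 + s turns it into a multiple of s^2.\<close>

lemma neg_ln_one_plus_le:
  fixes s M :: real
  assumes "1 / M \<le> 1 + s" "0 < M"
  shows "- ln (1 + s) \<le> - s + M * s\<^sup>2"
proof -
  have pos: "0 < 1 + s" using assms by (smt (verit) divide_pos_pos)
  have "- ln (1 + s) = ln (1 / (1 + s))" using pos by (simp add: ln_div)
  also have "\<dots> \<le> 1 / (1 + s) - 1" using pos by (intro ln_le_minus_one) simp
  also have "\<dots> = - s + s\<^sup>2 / (1 + s)" using pos by (simp add: field_simps power2_eq_square)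
  also have "s\<^sup>2 / (1 + s) \<le> M * s\<^sup>2"
  proof -
    have "1 \<le> M * (1 + s)" using assms by (simp add: field_simps)
    then have "s\<^sup>2 * 1 \<le> s\<^sup>2 * (M * (1 + s))" by (intro mult_left_mono) auto
    then show ?thesis using pos by (simp add: field_simps)
  qed
  finally show ?thesis by simp
qed

context fixed_rules
begin

definition flip :: "('v \<Rightarrow> bool) \<Rightarrow> 'v \<Rightarrow> 'v \<Rightarrow> bool" where
  "flip x v = x(v := \<not> x v)"

definition sends :: "'v \<Rightarrow> nat" where
  "sends v = card {t. t < T \<and> vs ! t = v}"

text \<open>Its mean under the transcript distribution on \<open>x\<close> is the relative entropy
  from the transcripts on \<open>x\<close> to those on \<open>flip x v\<close>.\<close>

definition log_ratio :: "(bool \<times> bool) list \<Rightarrow> ('v \<Rightarrow> bool) \<Rightarrow> 'v \<Rightarrow> real" where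
  "log_ratio H x v = ln (likelihood H x / likelihood H (flip x v))"

lemma flipped_flip_subset: "flipped H x (flip x v) w \<subseteq> {w} \<times> {t. t < T \<and> vs ! t = v}"
  by (auto simp: flipped_def flip_def)

lemma card_flipped_flip: "card (flipped H x (flip x v) w) \<le> sends v"
proof -
  have "card (flipped H x (flip x v) w) \<le> card ({w} \<times> {t. t < T \<and> vs ! t = v})"
    by (intro card_mono flipped_flip_subset) auto
  then show ?thesis by (simp add: sends_def card_cartesian_product_singleton)
qed

lemma likelihood_pos_iff: "0 < likelihood H x \<longleftrightarrow> (\<forall>w\<in>V. 0 < factor H w x)"
proof
  assume L: "0 < likelihood H x"
  show "\<forall>w\<in>V. 0 < factor H w x"
  proof
    fix w assume "w \<in> V"
    then have "factor H w x \<noteq> 0"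
      using L prod_zero[OF finite_V, of "\<lambda>w. factor H w x"] unfolding likelihood_def by fastforce
    then show "0 < factor H w x" using factor_nonneg[of H w x] by simp
  qed
qed (auto simp: likelihood_def intro: prod_pos)

lemma likelihood_pos_iff': "0 < likelihood H x \<longleftrightarrow> 0 < likelihood H x'"
  unfolding likelihood_pos_iff using factor_pos_iff[of _ H x x'] by blast

lemma ln_likelihood:
  assumes "0 < likelihood H x"
  shows "ln (likelihood H x) = (\<Sum>w\<in>V. ln (factor H w x))"
  using assms unfolding likelihood_def
  by (intro ln_prod) (use assms finite_V in \<open>auto simp: likelihood_pos_iff\<close>)

text \<open>The level-one inequality at the receiver \<open>w\<close>, for the event of agreeing
  with \<open>H\<close>. Flipping the input of \<open>v\<close> affects only time steps with sender
  \<open>v\<close>, so the affected sites are disjoint for different \<open>v\<close>.\<close>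

lemma sum_factor_ratio_sq:
  assumes "I \<subseteq> V" "1 \<le> M" "\<And>v. v \<in> I \<Longrightarrow> odds \<epsilon> ^ sends v \<le> M"
    and w: "w \<in> V" and pos: "0 < factor H w x"
  shows "(\<Sum>v\<in>I. (factor H w (flip x v) / factor H w x - 1)\<^sup>2) \<le> 4 * M\<^sup>2 * ln (1 / factor H w x)"
proof (rule level_one_inequality[where D = "\<lambda>v. flipped H x (flip x v) w" and B = "agrees H x w"
      and A = sites and I = I and b = "factor H w x" and \<epsilon> = \<epsilon>])
  show "finite I" using assms(1) finite_V by (rule finite_subset)
  have "flipped H x (flip x u) w \<inter> flipped H x (flip x v) w = {}" if "u \<noteq> v" for u v
    using flipped_flip_subset[of H x u w] flipped_flip_subset[of H x v w] that by fastforce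
  then show "disjoint_family_on (\<lambda>v. flipped H x (flip x v) w) I"
    by (auto simp: disjoint_family_on_def)
  show "flipped H x (flip x v) w \<subseteq> sites" for v using flipped_subset[OF w] .
  show "flip_weight \<epsilon> (flipped H x (flip x v) w) \<eta> \<le> M" if "v \<in> I" for v \<eta>
  proof -
    have "flip_weight \<epsilon> (flipped H x (flip x v) w) \<eta> \<le> odds \<epsilon> ^ card (flipped H x (flip x v) w)"
      by (rule flip_weight_le[OF \<epsilon>])
    also have "\<dots> \<le> odds \<epsilon> ^ sends v"
      using card_flipped_flip odds_ge_1[OF \<epsilon>] by (intro power_increasing)
    finally show ?thesis using assms(3)[OF that] by linarith
  qed
qed (use finite_sites assms(2) \<epsilon> pos w in \<open>simp_all add: factor_def[symmetric] factor_flip[symmetric]\<close>)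

text \<open>Let \<open>w\<close> perceive \<open>x'\<close> while all other sensors perceive
  \<open>x\<close>. This hybrid also defines a probability distribution on transcripts, and the sum
  is the difference of two total masses.\<close>

lemma expected_factor_ratio:
  assumes "w \<in> V"
  shows "(\<Sum>H\<in>transcripts. likelihood H x * (factor H w x' / factor H w x - 1)) = 0"
proof -
  define \<xi> where "\<xi> u = (if u = w then x' else x)" for u
  have *: "(\<Prod>u\<in>V. factor H u (\<xi> u)) = likelihood H x * (factor H w x' / factor H w x)" for H
  proof -
    have "(\<Prod>u\<in>V. factor H u (\<xi> u)) = factor H w x' * (\<Prod>u\<in>V - {w}. factor H u (\<xi> u))"
      using prod.remove[OF finite_V assms, of "\<lambda>u. factor H u (\<xi> u)"] by (simp add: \<xi>_def)
    also have "(\<Prod>u\<in>V - {w}. factor H u (\<xi> u)) = (\<Prod>u\<in>V - {w}. factor H u x)"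
      by (intro prod.cong refl) (auto simp: \<xi>_def)
    finally have eq: "(\<Prod>u\<in>V. factor H u (\<xi> u)) = factor H w x' * (\<Prod>u\<in>V - {w}. factor H u x)" .
    have L: "likelihood H x = factor H w x * (\<Prod>u\<in>V - {w}. factor H u x)"
      unfolding likelihood_def by (rule prod.remove[OF finite_V assms])
    show ?thesis
    proof (cases "factor H w x = 0")
      case True
      then have "factor H w x' = 0"
        using factor_pos_iff[OF assms, of H x x'] factor_nonneg[of H w x'] by simp
      then show ?thesis unfolding eq by simp
    next
      case False
      then show ?thesis unfolding eq L by simp
    qed
  qed
  have "(\<Sum>H\<in>transcripts. likelihood H x * (factor H w x' / factor H w x - 1)) =
      (\<Sum>H\<in>transcripts. (\<Prod>u\<in>V. factor H u (\<xi> u)) - likelihood H x)"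
    unfolding * by (simp add: right_diff_distrib)
  also have "\<dots> = 0"
    by (simp add: sum_subtractf sum_transcripts sum_likelihood)
  finally show ?thesis .
qed

text \<open>
  The logarithm of the likelihood ratio is expanded to second order. The first-order terms vanish
  in expectation, and the second-order terms are controlled by the entropy of the transcript.
\<close>

lemma sum_expected_log_ratio:
  assumes I: "I \<subseteq> V" and M: "1 \<le> M" "\<And>v. v \<in> I \<Longrightarrow> odds \<epsilon> ^ sends v \<le> M"
  shows "(\<Sum>v\<in>I. \<Sum>H\<in>transcripts. likelihood H x * \<bar>log_ratio H x v\<bar>)
    \<le> 4 * M ^ 3 * (real T * ln 4) + 2 * real (card I)"
proof -
  define s where "s w v H = factor H w (flip x v) / factor H w x - 1" for w v H
  have finI: "finite I" using I finite_V by (rule finite_subset)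
  have bound: "likelihood H x * \<bar>log_ratio H x v\<bar> \<le>
      2 * likelihood H (flip x v) + (\<Sum>w\<in>V. - (likelihood H x * s w v H) + likelihood H x * (M * (s w v H)\<^sup>2))"
    if v: "v \<in> I" for v H
  proof (cases "0 < likelihood H x")
    case False
    then have "likelihood H x = 0" using likelihood_nonneg[of H x] by simp
    then show ?thesis using likelihood_nonneg[of H "flip x v"] by simp
  next
    case L: True
    then have L': "0 < likelihood H (flip x v)" using likelihood_pos_iff' by blast
    have f: "0 < factor H w x" "0 < factor H w (flip x v)" if "w \<in> V" for w
      using L L' that unfolding likelihood_pos_iff by auto
    have "- log_ratio H x v \<le> likelihood H (flip x v) / likelihood H x"
      using ln_le_minus_one[of "likelihood H (flip x v) / likelihood H x"] L L'
      by (simp add: log_ratio_def ln_div)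
    moreover have "0 \<le> likelihood H (flip x v) / likelihood H x" using L L' by simp
    \<comment> \<open>An absolute value is the number itself plus twice its negative part. The
      negative part is at most the reversed likelihood ratio, which after weighting sums to 1 over
      the transcripts.\<close>
    ultimately have abs: "\<bar>log_ratio H x v\<bar> \<le> 2 * (likelihood H (flip x v) / likelihood H x) + log_ratio H x v"
      by linarith
    have "log_ratio H x v = (\<Sum>w\<in>V. - ln (1 + s w v H))"
    proof -
      have "log_ratio H x v = (\<Sum>w\<in>V. ln (factor H w x)) - (\<Sum>w\<in>V. ln (factor H w (flip x v)))"
        using L L' by (simp add: log_ratio_def ln_div ln_likelihood)
      also have "\<dots> = (\<Sum>w\<in>V. - ln (1 + s w v H))"
        unfolding sum_subtractf[symmetric]
      proof (intro sum.cong refl)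
        fix w assume "w \<in> V"
        from f[OF this] show "ln (factor H w x) - ln (factor H w (flip x v)) = - ln (1 + s w v H)"
          by (simp add: s_def ln_div)
      qed
      finally show ?thesis .
    qed
    \<comment> \<open>The expansion applies because a flip of \<open>v\<close> changes each factor
      by at most the factor \<open>M\<close>, so 1 + s is at least 1 / M.\<close>
    also have "\<dots> \<le> (\<Sum>w\<in>V. - s w v H + M * (s w v H)\<^sup>2)"
    proof (intro sum_mono neg_ln_one_plus_le)
      fix w assume w: "w \<in> V"
      have "factor H w x \<le> odds \<epsilon> ^ sends v * factor H w (flip x v)"
        by (rule factor_ratio[OF w card_flipped_flip])
      also have "\<dots> \<le> M * factor H w (flip x v)"
        using M(2)[OF v] factor_nonneg by (rule mult_right_mono)
      finally show "1 / M \<le> 1 + s w v H" using f[OF w] M by (simp add: s_def field_simps)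
    qed (use M in simp)
    finally have "\<bar>log_ratio H x v\<bar> \<le> 2 * (likelihood H (flip x v) / likelihood H x) + (\<Sum>w\<in>V. - s w v H + M * (s w v H)\<^sup>2)"
      using abs by linarith
    then have "likelihood H x * \<bar>log_ratio H x v\<bar> \<le>
        likelihood H x * (2 * (likelihood H (flip x v) / likelihood H x) + (\<Sum>w\<in>V. - s w v H + M * (s w v H)\<^sup>2))"
      using L by (intro mult_left_mono) auto
    then show ?thesis using L by (simp add: distrib_left right_diff_distrib sum_distrib_left)
  qed
  have "(\<Sum>v\<in>I. \<Sum>H\<in>transcripts. likelihood H x * \<bar>log_ratio H x v\<bar>) \<le>
    (\<Sum>v\<in>I. \<Sum>H\<in>transcripts. 2 * likelihood H (flip x v) +
      (\<Sum>w\<in>V. - (likelihood H x * s w v H) + likelihood H x * (M * (s w v H)\<^sup>2)))"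
    using bound by (intro sum_mono)
  also have "\<dots> = (\<Sum>v\<in>I. \<Sum>H\<in>transcripts. 2 * likelihood H (flip x v)) +
      (\<Sum>v\<in>I. \<Sum>H\<in>transcripts. \<Sum>w\<in>V. - (likelihood H x * s w v H)) +
      (\<Sum>v\<in>I. \<Sum>H\<in>transcripts. \<Sum>w\<in>V. likelihood H x * (M * (s w v H)\<^sup>2))"
    unfolding sum.distrib by (simp only: add.assoc)
  also have "(\<Sum>v\<in>I. \<Sum>H\<in>transcripts. 2 * likelihood H (flip x v)) = 2 * real (card I)"
    by (simp add: sum_likelihood flip: sum_distrib_left)
  also have "(\<Sum>v\<in>I. \<Sum>H\<in>transcripts. \<Sum>w\<in>V. - (likelihood H x * s w v H)) = 0"
  proof (rule sum.neutral, rule ballI)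
    fix v assume "v \<in> I"
    have "(\<Sum>H\<in>transcripts. \<Sum>w\<in>V. - (likelihood H x * s w v H)) =
        (\<Sum>w\<in>V. - (\<Sum>H\<in>transcripts. likelihood H x * s w v H))"
      by (subst sum.swap) (simp add: sum_negf)
    also have "\<dots> = 0"
      unfolding s_def using expected_factor_ratio by (intro sum.neutral ballI) simp
    finally show "(\<Sum>H\<in>transcripts. \<Sum>w\<in>V. - (likelihood H x * s w v H)) = 0" .
  qed
  \<comment> \<open>The level-one inequality bounds the squares at each receiver by ln (1 / factor).
    Over all receivers these logarithms add up to ln (1 / likelihood), whose mean is the entropy of
    the transcript.\<close>
  also have "(\<Sum>v\<in>I. \<Sum>H\<in>transcripts. \<Sum>w\<in>V. likelihood H x * (M * (s w v H)\<^sup>2)) \<le> 4 * M ^ 3 * (real T * ln 4)"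
  proof -
    have "(\<Sum>v\<in>I. \<Sum>H\<in>transcripts. \<Sum>w\<in>V. likelihood H x * (M * (s w v H)\<^sup>2)) =
        (\<Sum>H\<in>transcripts. \<Sum>v\<in>I. \<Sum>w\<in>V. likelihood H x * (M * (s w v H)\<^sup>2))"
      by (rule sum.swap)
    also have "\<dots> = (\<Sum>H\<in>transcripts. \<Sum>w\<in>V. \<Sum>v\<in>I. likelihood H x * (M * (s w v H)\<^sup>2))"
      by (intro sum.cong refl sum.swap)
    also have "\<dots> = (\<Sum>H\<in>transcripts. likelihood H x * M * (\<Sum>w\<in>V. \<Sum>v\<in>I. (s w v H)\<^sup>2))"
      by (simp add: sum_distrib_left mult_ac)
    also have "\<dots> \<le> (\<Sum>H\<in>transcripts. 4 * M ^ 3 * (likelihood H x * ln (1 / likelihood H x)))"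
    proof (rule sum_mono)
      fix H
      show "likelihood H x * M * (\<Sum>w\<in>V. \<Sum>v\<in>I. (s w v H)\<^sup>2) \<le> 4 * M ^ 3 * (likelihood H x * ln (1 / likelihood H x))"
      proof (cases "0 < likelihood H x")
        case False
        then have "likelihood H x = 0" using likelihood_nonneg[of H x] by simp
        then show ?thesis by simp
      next
        case True
        then have f: "\<And>w. w \<in> V \<Longrightarrow> 0 < factor H w x" unfolding likelihood_pos_iff by auto
        have "(\<Sum>w\<in>V. \<Sum>v\<in>I. (s w v H)\<^sup>2) \<le> (\<Sum>w\<in>V. 4 * M\<^sup>2 * ln (1 / factor H w x))"
          unfolding s_def by (intro sum_mono sum_factor_ratio_sq[OF I M] f)
        also have "\<dots> = 4 * M\<^sup>2 * ln (1 / likelihood H x)"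
        proof -
          have "ln (1 / likelihood H x) = - ln (likelihood H x)" using True by (simp add: ln_div)
          also have "\<dots> = (\<Sum>w\<in>V. ln (1 / factor H w x))"
            unfolding ln_likelihood[OF True] sum_negf[symmetric]
            by (intro sum.cong refl) (use f in \<open>simp add: ln_div less_imp_neq[THEN not_sym]\<close>)
          finally show ?thesis by (simp add: sum_distrib_left)
        qed
        finally have "likelihood H x * M * (\<Sum>w\<in>V. \<Sum>v\<in>I. (s w v H)\<^sup>2) \<le>
            likelihood H x * M * (4 * M\<^sup>2 * ln (1 / likelihood H x))"
          using True M by (intro mult_left_mono) auto
        then show ?thesis by (simp add: power2_eq_square power3_eq_cube mult_ac)
      qed
    qed
    also have "\<dots> = 4 * M ^ 3 * (\<Sum>H\<in>transcripts. likelihood H x * ln (1 / likelihood H x))"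
      by (simp add: sum_distrib_left)
    also have "\<dots> \<le> 4 * M ^ 3 * ln (card transcripts)"
    proof (intro mult_left_mono entropy_le_ln_card finite_transcripts likelihood_nonneg sum_likelihood)
      show "transcripts \<noteq> {}" using card_transcripts by force
    qed (use M in simp)
    finally show ?thesis by (simp add: card_transcripts ln_realpow)
  qed
  finally show ?thesis by simp
qed

end

section \<open>The bias of the parity\<close>

text \<open>Let q be the smaller number divided by the larger; it equals exp (- |ln (a / b)|). The
  claim reduces to 1 - q \<le> exp (- q) \<le> (1 + q) exp (- q).\<close>

lemma abs_diff_le_exp:
  fixes a b :: real
  assumes "0 < a" "0 < b"
  shows "\<bar>a - b\<bar> \<le> (a + b) * exp (- exp (- \<bar>ln (a / b)\<bar>))"
proof -
  have *: "a - b \<le> (a + b) * exp (- exp (- \<bar>ln (a / b)\<bar>))" if "0 < b" "b \<le> a" for a b :: real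
  proof -
    define q where "q = b / a"
    have ln: "- \<bar>ln (a / b)\<bar> = ln q" using that by (simp add: q_def ln_div abs_if)
    have q: "0 < q" using that by (simp add: q_def)
    have "a * (1 - q) \<le> a * ((1 + q) * exp (- q))"
    proof (rule mult_left_mono)
      have "1 - q \<le> 1 * exp (- q)" using exp_ge_add_one_self[of "- q"] by simp
      also have "\<dots> \<le> (1 + q) * exp (- q)" using q by (intro mult_right_mono) auto
      finally show "1 - q \<le> (1 + q) * exp (- q)" .
    qed (use that in simp)
    moreover have "a * (1 - q) = a - b" "a * ((1 + q) * exp (- q)) = (a + b) * exp (- q)"
      using that by (simp_all add: q_def algebra_simps)
    ultimately show ?thesis unfolding ln using q by simp
  qed
  show ?thesis
  proof (cases "b \<le> a")
    case True
    then show ?thesis using *[of b a] assms by simp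
  next
    case False
    have "\<bar>ln (b / a)\<bar> = \<bar>ln (a / b)\<bar>" using assms by (simp add: ln_div)
    then show ?thesis using *[of a b] False assms by (simp add: add.commute)
  qed
qed

lemma prod_if_mem:
  assumes "finite J" "A \<subseteq> J"
  shows "(\<Prod>v\<in>J. F v (v \<in> A)) = (\<Prod>v\<in>A. F v True) * (\<Prod>v\<in>J - A. F v False)"
proof -
  have "(\<Prod>v\<in>J. F v (v \<in> A)) = (\<Prod>v\<in>A. F v (v \<in> A)) * (\<Prod>v\<in>J - A. F v (v \<in> A))"
    using prod.subset_diff[OF assms(2,1), of "\<lambda>v. F v (v \<in> A)"] by (simp add: mult.commute)
  then show ?thesis using assms(2) by (simp add: subset_iff)
qed

text \<open>The alternating sum is the expansion of the product of
  \<open>F v False - F v True\<close>: the bias of a parity of independent bits is the product of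
  their biases.\<close>

lemma alternating_sum_bound:
  fixes F :: "'a \<Rightarrow> bool \<Rightarrow> real"
  assumes fin: "finite J" and pos: "\<And>v b. v \<in> J \<Longrightarrow> 0 < F v b"
  shows "\<bar>\<Sum>A\<in>Pow J. (- 1) ^ card A * (\<Prod>v\<in>J. F v (v \<in> A))\<bar> \<le>
    (\<Sum>A\<in>Pow J. \<Prod>v\<in>J. F v (v \<in> A)) * exp (- (\<Sum>v\<in>J. exp (- \<bar>ln (F v False / F v True)\<bar>)))"
proof -
  have "(\<Sum>A\<in>Pow J. (- 1) ^ card A * (\<Prod>v\<in>J. F v (v \<in> A))) = (\<Prod>v\<in>J. F v False - F v True)"
    unfolding prod_diff_conv_sum[OF fin]
    by (intro sum.cong refl) (simp add: prod_if_mem[OF fin] mult.assoc)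
  then have "\<bar>\<Sum>A\<in>Pow J. (- 1) ^ card A * (\<Prod>v\<in>J. F v (v \<in> A))\<bar> = (\<Prod>v\<in>J. \<bar>F v False - F v True\<bar>)"
    by (simp add: abs_prod)
  also have "\<dots> \<le> (\<Prod>v\<in>J. (F v False + F v True) * exp (- exp (- \<bar>ln (F v False / F v True)\<bar>)))"
    using abs_diff_le_exp pos by (intro prod_mono) auto
  also have "\<dots> = (\<Prod>v\<in>J. F v True + F v False) * exp (- (\<Sum>v\<in>J. exp (- \<bar>ln (F v False / F v True)\<bar>)))"
    by (simp add: prod.distrib exp_sum[OF fin, symmetric] sum_negf add.commute)
  also have "(\<Prod>v\<in>J. F v True + F v False) = (\<Sum>A\<in>Pow J. \<Prod>v\<in>J. F v (v \<in> A))"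
    unfolding prod_add[OF fin] by (intro sum.cong refl) (simp add: prod_if_mem[OF fin])
  finally show ?thesis .
qed

lemma sum_Pow_split:
  fixes f :: "'a set \<Rightarrow> 'b :: comm_monoid_add"
  assumes "J \<subseteq> V"
  shows "(\<Sum>X\<in>Pow V. f X) = (\<Sum>Z\<in>Pow (V - J). \<Sum>A\<in>Pow J. f (Z \<union> A))"
proof -
  have "(\<Sum>X\<in>Pow V. f X) = (\<Sum>(Z, A)\<in>Pow (V - J) \<times> Pow J. f (Z \<union> A))"
    by (rule sum.reindex_bij_witness[of _ "\<lambda>(Z, A). Z \<union> A" "\<lambda>X. (X - J, X \<inter> J)"])
       (use assms in \<open>auto simp: Un_Diff_Int intro!: arg_cong[of _ _ f]\<close>)
  then show ?thesis by (simp add: sum.cartesian_product)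
qed

lemma parity_set: "finite V \<Longrightarrow> X \<subseteq> V \<Longrightarrow> parity V (\<lambda>v. v \<in> X) = (- 1) ^ card X"
  by (simp add: parity_def of_bool_def sum.If_cases Int_absorb1)

context fixed_rules
begin

text \<open>For a positive likelihood and uniform inputs, each summand is the smaller divided by the
  larger of the two posterior probabilities of the bit of \<open>v\<close>, given \<open>H\<close>
  and all other input bits.\<close>

definition uncertainty :: "'v set \<Rightarrow> (bool \<times> bool) list \<Rightarrow> ('v \<Rightarrow> bool) \<Rightarrow> real" where
  "uncertainty J H x = (\<Sum>v\<in>J. exp (- \<bar>log_ratio H x v\<bar>))"

text \<open>Common receivers are excluded, but adjacency within \<open>J\<close> is not: a factor
  involves only the inputs of the neighbours of its receiver.\<close>

definition isolated :: "'v set \<Rightarrow> bool" where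
  "isolated J \<longleftrightarrow> (\<forall>u\<in>J. \<forall>v\<in>J. \<forall>w\<in>V. adj u w \<longrightarrow> adj v w \<longrightarrow> u = v)"

text \<open>
  Given the transcript and the inputs outside \<open>J\<close>, the inputs of the sensors in \<open>J\<close> are
  independent, because each receiver hears at most one of them.
\<close>

lemma isolated_alternating_sum:
  assumes J: "J \<subseteq> V" "isolated J" and Z: "Z \<subseteq> V - J"
  shows "\<bar>\<Sum>A\<in>Pow J. (- 1) ^ card A * likelihood H (\<lambda>v. v \<in> Z \<union> A)\<bar> \<le>
    (\<Sum>A\<in>Pow J. likelihood H (\<lambda>v. v \<in> Z \<union> A) * exp (- uncertainty J H (\<lambda>v. v \<in> Z \<union> A)))"
proof (cases "0 < likelihood H (\<lambda>v. v \<in> Z)")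
  case False
  have "likelihood H x = 0" for x
    using False likelihood_pos_iff'[of H "\<lambda>v. v \<in> Z" x] likelihood_nonneg[of H x] by linarith
  then show ?thesis by simp
next
  case True
  then have pos: "0 < likelihood H x" for x using likelihood_pos_iff'[of H "\<lambda>v. v \<in> Z" x] by blast
  have fin: "finite J" using J(1) finite_V by (rule finite_subset)
  define N where "N v = {w \<in> V. adj v w}" for v
  \<comment> \<open>\<open>F v b\<close> collects the receivers that hear \<open>v\<close> when its
    bit is \<open>b\<close>; \<open>K\<close> collects those that hear nobody in
    \<open>J\<close>.\<close>
  define F where "F v b = (\<Prod>w\<in>N v. factor H w (\<lambda>u. u \<in> Z \<or> u = v \<and> b))" for v b
  define K where "K = (\<Prod>w\<in>V - \<Union>(N ` J). factor H w (\<lambda>u. u \<in> Z))"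
  have fpos: "0 < factor H w x" if "w \<in> V" for w x
    using pos[of x] that unfolding likelihood_pos_iff by blast
  have Fpos: "0 < F v b" for v b
    unfolding F_def by (intro prod_pos fpos) (auto simp: N_def)
  have Kpos: "0 < K" unfolding K_def by (intro prod_pos fpos) auto
  have fact: "likelihood H (\<lambda>v. v \<in> Z \<union> A) = K * (\<Prod>v\<in>J. F v (v \<in> A))" if A: "A \<subseteq> J" for A
  proof -
    have "likelihood H (\<lambda>v. v \<in> Z \<union> A) =
        (\<Prod>w\<in>V - \<Union>(N ` J). factor H w (\<lambda>v. v \<in> Z \<union> A)) * (\<Prod>w\<in>\<Union>(N ` J). factor H w (\<lambda>v. v \<in> Z \<union> A))"
      unfolding likelihood_def by (rule prod.subset_diff) (auto simp: N_def finite_V)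
    also have "(\<Prod>w\<in>V - \<Union>(N ` J). factor H w (\<lambda>v. v \<in> Z \<union> A)) = K"
      unfolding K_def by (intro prod.cong refl factor_cong) (use A in \<open>auto simp: N_def\<close>)
    also have "(\<Prod>w\<in>\<Union>(N ` J). factor H w (\<lambda>v. v \<in> Z \<union> A)) =
        (\<Prod>v\<in>J. \<Prod>w\<in>N v. factor H w (\<lambda>v. v \<in> Z \<union> A))"
      by (rule prod.UNION_disjoint) (use fin finite_V J(2) in \<open>auto simp: N_def isolated_def\<close>)
    also have "\<dots> = (\<Prod>v\<in>J. F v (v \<in> A))"
      unfolding F_def
    proof (intro prod.cong refl factor_cong)
      fix v w u assume *: "v \<in> J" "w \<in> N v" "u \<in> V" "adj u w"
      then have "u \<in> A \<Longrightarrow> u = v"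
        using A J(2) unfolding isolated_def N_def by blast
      then show "(u \<in> Z \<union> A) = (u \<in> Z \<or> u = v \<and> v \<in> A)" by auto
    qed
    finally show ?thesis .
  qed
  \<comment> \<open>Flipping \<open>v\<close> toggles its membership in \<open>A\<close>. All
    factors except \<open>F v\<close> cancel in the ratio, and the absolute value removes the
    dependence on \<open>A\<close>.\<close>
  have lr: "\<bar>log_ratio H (\<lambda>v. v \<in> Z \<union> A) v\<bar> = \<bar>ln (F v False / F v True)\<bar>" if A: "A \<subseteq> J" and v: "v \<in> J" for A v
  proof -
    define A' where "A' = (if v \<in> A then A - {v} else insert v A)"
    have A': "A' \<subseteq> J" using A v by (auto simp: A'_def)
    have flip: "flip (\<lambda>v. v \<in> Z \<union> A) v = (\<lambda>v. v \<in> Z \<union> A')"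
      using Z v by (auto simp: flip_def A'_def fun_eq_iff)
    define R where "R = (\<Prod>u\<in>J - {v}. F u (u \<in> A))"
    have R': "R = (\<Prod>u\<in>J - {v}. F u (u \<in> A'))"
      unfolding R_def by (intro prod.cong refl) (auto simp: A'_def)
    have Rpos: "0 < R" unfolding R_def by (intro prod_pos Fpos)
    have "likelihood H (\<lambda>v. v \<in> Z \<union> A) = K * (F v (v \<in> A) * R)"
      unfolding fact[OF A] R_def by (simp add: prod.remove[OF fin v])
    moreover have "likelihood H (\<lambda>v. v \<in> Z \<union> A') = K * (F v (v \<in> A') * R)"
      unfolding fact[OF A'] R' by (simp add: prod.remove[OF fin v])
    moreover have "(v \<in> A') = (v \<notin> A)" by (auto simp: A'_def)
    ultimately have "log_ratio H (\<lambda>v. v \<in> Z \<union> A) v = ln (F v (v \<in> A) / F v (v \<notin> A))"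
      unfolding log_ratio_def flip using Kpos Rpos by simp
    then show ?thesis using Fpos[of v True] Fpos[of v False]
      by (cases "v \<in> A") (simp_all add: ln_div)
  qed
  have u: "uncertainty J H (\<lambda>v. v \<in> Z \<union> A) = (\<Sum>v\<in>J. exp (- \<bar>ln (F v False / F v True)\<bar>))" if "A \<subseteq> J" for A
    unfolding uncertainty_def using lr[OF that] by (intro sum.cong refl) simp
  have "(\<Sum>A\<in>Pow J. (- 1) ^ card A * likelihood H (\<lambda>v. v \<in> Z \<union> A)) =
      K * (\<Sum>A\<in>Pow J. (- 1) ^ card A * (\<Prod>v\<in>J. F v (v \<in> A)))"
    unfolding sum_distrib_left by (intro sum.cong refl) (simp add: fact mult_ac del: Un_iff)
  then have "\<bar>\<Sum>A\<in>Pow J. (- 1) ^ card A * likelihood H (\<lambda>v. v \<in> Z \<union> A)\<bar> =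
      K * \<bar>\<Sum>A\<in>Pow J. (- 1) ^ card A * (\<Prod>v\<in>J. F v (v \<in> A))\<bar>"
    using Kpos by (simp add: abs_mult)
  also have "\<dots> \<le> K * ((\<Sum>A\<in>Pow J. \<Prod>v\<in>J. F v (v \<in> A)) * exp (- (\<Sum>v\<in>J. exp (- \<bar>ln (F v False / F v True)\<bar>))))"
    using Kpos by (intro mult_left_mono alternating_sum_bound fin Fpos) auto
  also have "\<dots> = (\<Sum>A\<in>Pow J. likelihood H (\<lambda>v. v \<in> Z \<union> A) * exp (- uncertainty J H (\<lambda>v. v \<in> Z \<union> A)))"
    unfolding sum_distrib_left sum_distrib_right by (intro sum.cong refl) (simp add: fact u del: Un_iff)
  finally show ?thesis .
qed

definition success :: "('v \<Rightarrow> bool) \<Rightarrow> real" where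
  "success x = noise_exp \<epsilon> sites
     (\<lambda>\<eta>. of_bool (bit_sign (protocol_output adj vs g x \<eta>) = parity V x))"

text \<open>Fix the transcript and the inputs outside \<open>J\<close>. As the last sender is not in
  \<open>J\<close>, the output is then constant, so the advantage over guessing is at most the bias
  of the parity of the bits in \<open>J\<close>.\<close>

lemma sum_success_le:
  assumes J: "J \<subseteq> V" "isolated J" and last: "vs \<noteq> []" "last vs \<notin> J"
  shows "2 * (\<Sum>X\<in>Pow V. success (\<lambda>v. v \<in> X)) \<le> 2 ^ card V +
    (\<Sum>X\<in>Pow V. \<Sum>H\<in>transcripts. likelihood H (\<lambda>v. v \<in> X) * exp (- uncertainty J H (\<lambda>v. v \<in> X)))"
proof -
  define sg where "sg H X = real_of_int (bit_sign (chosen (last H) (last vs \<in> X)))" for H X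
  have sg1: "\<bar>sg H X\<bar> = 1" for H X by (simp add: sg_def bit_sign_def power_abs)
  \<comment> \<open>The indicator that two signs agree is half of 1 plus their product.\<close>
  have succ: "2 * success (\<lambda>v. v \<in> X) = 1 + (\<Sum>H\<in>transcripts. likelihood H (\<lambda>v. v \<in> X) * (sg H X * (- 1) ^ card X))"
    if X: "X \<subseteq> V" for X
  proof -
    have "success (\<lambda>v. v \<in> X) =
      (\<Sum>H\<in>transcripts. (\<Prod>w\<in>V. factor H w (\<lambda>v. v \<in> X)) * ((1 + sg H X * (- 1) ^ card X) / 2))"
      unfolding success_def
    proof (rule sum_transcripts_noise_exp[symmetric])
      fix H \<eta> assume H: "H \<in> transcripts" "\<forall>w\<in>V. agrees H (\<lambda>v. v \<in> X) w \<eta>"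
      show "of_bool (bit_sign (protocol_output adj vs g (\<lambda>v. v \<in> X) \<eta>) = parity V (\<lambda>v. v \<in> X)) =
          (1 + sg H X * (- 1) ^ card X) / 2"
        unfolding protocol_output_eq[OF H last(1)] parity_set[OF finite_V X] sg_def
        by (cases "even (card X)") (auto simp: bit_sign_def)
    qed
    also have "\<dots> = (\<Sum>H\<in>transcripts. likelihood H (\<lambda>v. v \<in> X) / 2 + likelihood H (\<lambda>v. v \<in> X) * (sg H X * (- 1) ^ card X) / 2)"
      by (simp add: likelihood_def algebra_simps add_divide_distrib)
    finally show ?thesis
      by (simp add: sum.distrib sum_likelihood flip: sum_divide_distrib)
  qed
  have "(\<Sum>X\<in>Pow V. \<Sum>H\<in>transcripts. likelihood H (\<lambda>v. v \<in> X) * (sg H X * (- 1) ^ card X)) \<le>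
    (\<Sum>X\<in>Pow V. \<Sum>H\<in>transcripts. likelihood H (\<lambda>v. v \<in> X) * exp (- uncertainty J H (\<lambda>v. v \<in> X)))"
    unfolding sum_Pow_split[OF J(1)]
  proof (rule sum_mono)
    fix Z assume "Z \<in> Pow (V - J)"
    then have Z: "Z \<subseteq> V - J" "finite Z" using finite_V by (auto intro: finite_subset)
    have "(\<Sum>A\<in>Pow J. likelihood H (\<lambda>v. v \<in> Z \<union> A) * (sg H (Z \<union> A) * (- 1) ^ card (Z \<union> A))) \<le>
      (\<Sum>A\<in>Pow J. likelihood H (\<lambda>v. v \<in> Z \<union> A) * exp (- uncertainty J H (\<lambda>v. v \<in> Z \<union> A)))" for H
    proof -
      \<comment> \<open>Only the sign given by \<open>card A\<close> varies with \<open>A\<close>;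
        the output sign and the parity of \<open>Z\<close> factor out.\<close>
      have "(\<Sum>A\<in>Pow J. likelihood H (\<lambda>v. v \<in> Z \<union> A) * (sg H (Z \<union> A) * (- 1) ^ card (Z \<union> A))) =
          sg H Z * (- 1) ^ card Z * (\<Sum>A\<in>Pow J. (- 1) ^ card A * likelihood H (\<lambda>v. v \<in> Z \<union> A))"
        unfolding sum_distrib_left
      proof (intro sum.cong refl)
        fix A assume "A \<in> Pow J"
        then have A: "A \<subseteq> J" "finite A" using J(1) finite_V by (auto intro: finite_subset)
        then have "card (Z \<union> A) = card Z + card A" using Z by (intro card_Un_disjoint) auto
        moreover have "last vs \<notin> A" using last(2) A by auto
        then have "sg H (Z \<union> A) = sg H Z" by (simp add: sg_def)
        ultimately show "likelihood H (\<lambda>v. v \<in> Z \<union> A) * (sg H (Z \<union> A) * (- 1) ^ card (Z \<union> A)) =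
            sg H Z * (- 1) ^ card Z * ((- 1) ^ card A * likelihood H (\<lambda>v. v \<in> Z \<union> A))"
          by (simp add: power_add mult_ac)
      qed
      also have "\<dots> \<le> \<bar>\<dots>\<bar>" by (rule abs_ge_self)
      also have "\<dots> = \<bar>\<Sum>A\<in>Pow J. (- 1) ^ card A * likelihood H (\<lambda>v. v \<in> Z \<union> A)\<bar>"
        using sg1 by (simp add: abs_mult power_abs)
      also have "\<dots> \<le> (\<Sum>A\<in>Pow J. likelihood H (\<lambda>v. v \<in> Z \<union> A) * exp (- uncertainty J H (\<lambda>v. v \<in> Z \<union> A)))"
        by (rule isolated_alternating_sum[OF J Z(1)])
      finally show ?thesis .
    qed
    then show "(\<Sum>A\<in>Pow J. \<Sum>H\<in>transcripts. likelihood H (\<lambda>v. v \<in> Z \<union> A) * (sg H (Z \<union> A) * (- 1) ^ card (Z \<union> A))) \<le>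
      (\<Sum>A\<in>Pow J. \<Sum>H\<in>transcripts. likelihood H (\<lambda>v. v \<in> Z \<union> A) * exp (- uncertainty J H (\<lambda>v. v \<in> Z \<union> A)))"
      unfolding sum.swap[of _ transcripts "Pow J"] by (rule sum_mono)
  qed
  moreover have "2 * (\<Sum>X\<in>Pow V. success (\<lambda>v. v \<in> X)) = 2 ^ card V +
      (\<Sum>X\<in>Pow V. \<Sum>H\<in>transcripts. likelihood H (\<lambda>v. v \<in> X) * (sg H X * (- 1) ^ card X))"
    unfolding sum_distrib_left using finite_V by (simp add: succ sum.distrib card_Pow)
  ultimately show ?thesis by simp
qed

end

section \<open>A well separated set of rarely sending sensors\<close>

text \<open>Greedy choice: each selected vertex removes itself and at most \<open>\<Delta>\<close>
  others.\<close>

lemma large_independent_set: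
  assumes "finite S" "\<And>u v. R u v \<Longrightarrow> R v u"
    and "\<And>v. v \<in> S \<Longrightarrow> real (card {u \<in> S. u \<noteq> v \<and> R u v}) \<le> \<Delta>"
  shows "\<exists>J\<subseteq>S. (\<forall>u\<in>J. \<forall>v\<in>J. R u v \<longrightarrow> u = v) \<and> real (card S) \<le> real (card J) * (\<Delta> + 1)"
  using assms(1,3)
proof (induction "card S" arbitrary: S rule: less_induct)
  case less
  show ?case
  proof (cases "S = {}")
    case True
    then show ?thesis by auto
  next
    case False
    then obtain v where v: "v \<in> S" by blast
    define U where "U = {u \<in> S. u \<noteq> v \<and> R u v}"
    define S' where "S' = S - insert v U"
    have fin: "finite U" "finite S'" using less.prems(1) by (auto simp: U_def S'_def)
    have sub: "S' \<subseteq> S" "v \<notin> S'" by (auto simp: S'_def)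
    have "card S' < card S" using less.prems(1) v sub by (intro psubset_card_mono) auto
    moreover have "real (card {u \<in> S'. u \<noteq> w \<and> R u w}) \<le> \<Delta>" if "w \<in> S'" for w
    proof -
      have "card {u \<in> S'. u \<noteq> w \<and> R u w} \<le> card {u \<in> S. u \<noteq> w \<and> R u w}"
        using less.prems(1) sub by (intro card_mono) auto
      then show ?thesis using less.prems(2)[of w] that sub by force
    qed
    ultimately obtain J where J: "J \<subseteq> S'" "\<forall>u\<in>J. \<forall>v\<in>J. R u v \<longrightarrow> u = v"
      "real (card S') \<le> real (card J) * (\<Delta> + 1)"
      using less.hyps[of S'] fin by metis
    have "card S = card S' + Suc (card U)"
    proof -
      have "card (S' \<union> insert v U) = card S' + card (insert v U)"
        using fin by (intro card_Un_disjoint) (auto simp: S'_def)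
      moreover have "S' \<union> insert v U = S" using v by (auto simp: S'_def U_def)
      moreover have "v \<notin> U" by (simp add: U_def)
      ultimately show ?thesis using fin by simp
    qed
    moreover have "real (card U) \<le> \<Delta>" unfolding U_def by (rule less.prems(2)[OF v])
    moreover have "v \<notin> J" using J(1) sub by auto
    moreover have "finite J" using J(1) fin(2) by (rule finite_subset)
    ultimately have card: "real (card S) \<le> real (card (insert v J)) * (\<Delta> + 1)"
      using J(3) by (simp add: algebra_simps)
    have nR: "\<not> R u v" "\<not> R v u" if "u \<in> J" for u
    proof -
      have "u \<in> S" "u \<noteq> v" "u \<notin> U" using that J(1) by (auto simp: S'_def)
      then show "\<not> R u v" by (simp add: U_def)
      then show "\<not> R v u" using assms(2) by blast
    qed
    then have "\<forall>u\<in>insert v J. \<forall>w\<in>insert v J. R u w \<longrightarrow> u = w" using J(2) by blast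
    moreover have "insert v J \<subseteq> S" using v J(1) sub by blast
    ultimately show ?thesis using card by blast
  qed
qed

text \<open>Markov's inequality for the counting measure.\<close>

lemma card_exceeding_le:
  fixes f :: "'a \<Rightarrow> real"
  assumes "finite S" "\<And>v. v \<in> S \<Longrightarrow> 0 \<le> f v" "0 < c" "sum f S \<le> b * c"
  shows "real (card {v \<in> S. c < f v}) \<le> b"
proof -
  have "real (card {v \<in> S. c < f v}) * c = (\<Sum>v\<in>{v \<in> S. c < f v}. c)" by simp
  also have "\<dots> \<le> (\<Sum>v\<in>{v \<in> S. c < f v}. f v)" by (intro sum_mono) auto
  also have "\<dots> \<le> sum f S" using assms(1,2) by (intro sum_mono2) auto
  finally have "real (card {v \<in> S. c < f v}) * c \<le> b * c" using assms(4) by linarith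
  then show ?thesis using assms(3) by simp
qed

text \<open>Jensen's inequality for exp (- y), obtained from the tangent at the mean.\<close>

lemma card_mult_exp_mean_le:
  fixes y :: "'a \<Rightarrow> real"
  assumes "finite J" "J \<noteq> {}"
  shows "real (card J) * exp (- (sum y J / card J)) \<le> (\<Sum>v\<in>J. exp (- y v))"
proof -
  define m where "m = real (card J)"
  define a where "a = sum y J / m"
  have m: "m > 0" using assms by (simp add: m_def card_gt_0_iff)
  have "exp (- a) * (1 + (a - y v)) \<le> exp (- y v)" for v
  proof -
    have "exp (- a) * (1 + (a - y v)) \<le> exp (- a) * exp (a - y v)"
      using exp_ge_add_one_self[of "a - y v"] by (intro mult_left_mono) auto
    then show ?thesis by (simp flip: exp_add)
  qed
  then have "(\<Sum>v\<in>J. exp (- a) * (1 + (a - y v))) \<le> (\<Sum>v\<in>J. exp (- y v))" by (rule sum_mono)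
  moreover have "(\<Sum>v\<in>J. exp (- a) * (1 + (a - y v))) = exp (- a) * (m + (m * a - sum y J))"
    by (simp add: m_def sum.distrib sum_subtractf flip: sum_distrib_left)
  ultimately show ?thesis using m by (simp add: a_def m_def mult.commute)
qed

context fixed_rules
begin

definition mean_log_ratio :: "'v \<Rightarrow> real" where
  "mean_log_ratio v =
     (\<Sum>X\<in>Pow V. \<Sum>H\<in>transcripts. likelihood H (\<lambda>u. u \<in> X) * \<bar>log_ratio H (\<lambda>u. u \<in> X) v\<bar>) / 2 ^ card V"

definition conflicts :: "('v \<times> 'v) set" where
  "conflicts = {(u, v). u \<in> V \<and> v \<in> V \<and> u \<noteq> v \<and> (\<exists>w\<in>V. adj u w \<and> adj v w)}"

lemma mean_log_ratio_nonneg: "0 \<le> mean_log_ratio v"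
  unfolding mean_log_ratio_def
  by (intro divide_nonneg_pos sum_nonneg mult_nonneg_nonneg likelihood_nonneg) auto

lemma sum_mean_log_ratio:
  assumes "I \<subseteq> V" "1 \<le> M" "\<And>v. v \<in> I \<Longrightarrow> odds \<epsilon> ^ sends v \<le> M"
  shows "sum mean_log_ratio I \<le> 4 * M ^ 3 * (real T * ln 4) + 2 * real (card I)"
proof -
  have "sum mean_log_ratio I =
      (\<Sum>X\<in>Pow V. \<Sum>v\<in>I. \<Sum>H\<in>transcripts. likelihood H (\<lambda>u. u \<in> X) * \<bar>log_ratio H (\<lambda>u. u \<in> X) v\<bar>) / 2 ^ card V"
    unfolding mean_log_ratio_def sum_divide_distrib[symmetric] by (subst sum.swap) simp
  also have "\<dots> \<le> (\<Sum>X\<in>Pow V. 4 * M ^ 3 * (real T * ln 4) + 2 * real (card I)) / 2 ^ card V"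
    by (intro divide_right_mono sum_mono sum_expected_log_ratio assms) auto
  also have "\<dots> = 4 * M ^ 3 * (real T * ln 4) + 2 * real (card I)"
    using finite_V by (simp add: card_Pow)
  finally show ?thesis .
qed

text \<open>The threshold \<open>Y\<close> separates two cases for the average |log ratio| over
  \<open>J\<close>. Averages of at least \<open>Y\<close> are rare by Markov, at the price
  \<open>\<kappa> / Y\<close>; below \<open>Y\<close>, Jensen makes the uncertainty at least
  \<open>card J * exp (- Y)\<close>.\<close>

lemma sum_success_le_of_mean_log_ratio:
  assumes J: "J \<subseteq> V" "isolated J" "J \<noteq> {}" and last: "vs \<noteq> []" "last vs \<notin> J"
    and \<kappa>: "\<And>v. v \<in> J \<Longrightarrow> mean_log_ratio v \<le> \<kappa>" and Y: "0 < Y"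
  shows "2 * (\<Sum>X\<in>Pow V. success (\<lambda>v. v \<in> X)) \<le>
    2 ^ card V * (1 + (\<kappa> / Y + exp (- (real (card J) * exp (- Y)))))"
proof -
  define m where "m = real (card J)"
  define n where "n = (2 :: real) ^ card V"
  define E where "E = exp (- (m * exp (- Y)))"
  have fin: "finite J" using J(1) finite_V by (rule finite_subset)
  have m: "m > 0" using J(3) fin by (simp add: m_def card_gt_0_iff)
  have n: "n > 0" by (simp add: n_def)
  have unc: "exp (- uncertainty J H x) \<le> (\<Sum>v\<in>J. \<bar>log_ratio H x v\<bar>) / (m * Y) + E" for H x
  proof -
    define a where "a = (\<Sum>v\<in>J. \<bar>log_ratio H x v\<bar>) / m"
    have a: "0 \<le> a" using m by (simp add: a_def sum_nonneg)
    have "m * exp (- a) \<le> uncertainty J H x"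
      using card_mult_exp_mean_le[OF fin J(3), of "\<lambda>v. \<bar>log_ratio H x v\<bar>"]
      by (simp add: m_def a_def uncertainty_def)
    then have "exp (- uncertainty J H x) \<le> exp (- (m * exp (- a)))" by simp
    also have "\<dots> \<le> a / Y + E"
    proof (cases "a \<ge> Y")
      case True
      have "exp (- (m * exp (- a))) \<le> 1" using m by simp
      also have "1 \<le> a / Y" using True Y by simp
      finally show ?thesis by (simp add: E_def add_increasing2)
    next
      case False
      then have "m * exp (- Y) \<le> m * exp (- a)" using m by simp
      then have "exp (- (m * exp (- a))) \<le> E" by (simp add: E_def)
      moreover have "0 \<le> a / Y" using a Y by simp
      ultimately show ?thesis by linarith
    qed
    finally show ?thesis by (simp add: a_def)
  qed
  have "(\<Sum>X\<in>Pow V. \<Sum>H\<in>transcripts. likelihood H (\<lambda>v. v \<in> X) * exp (- uncertainty J H (\<lambda>v. v \<in> X))) \<le>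
    (\<Sum>X\<in>Pow V. \<Sum>H\<in>transcripts. likelihood H (\<lambda>v. v \<in> X) * ((\<Sum>v\<in>J. \<bar>log_ratio H (\<lambda>v. v \<in> X) v\<bar>) / (m * Y) + E))"
    by (intro sum_mono mult_left_mono unc likelihood_nonneg)
  also have "\<dots> = (\<Sum>X\<in>Pow V. \<Sum>H\<in>transcripts. \<Sum>v\<in>J. likelihood H (\<lambda>v. v \<in> X) * \<bar>log_ratio H (\<lambda>v. v \<in> X) v\<bar>) / (m * Y) + n * E"
    by (simp add: distrib_left sum.distrib sum_likelihood n_def finite_V card_Pow sum_distrib_left
        flip: sum_distrib_right sum_divide_distrib)
  also have "(\<Sum>X\<in>Pow V. \<Sum>H\<in>transcripts. \<Sum>v\<in>J. likelihood H (\<lambda>v. v \<in> X) * \<bar>log_ratio H (\<lambda>v. v \<in> X) v\<bar>) =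
      (\<Sum>X\<in>Pow V. \<Sum>v\<in>J. \<Sum>H\<in>transcripts. likelihood H (\<lambda>v. v \<in> X) * \<bar>log_ratio H (\<lambda>v. v \<in> X) v\<bar>)"
    by (intro sum.cong refl sum.swap)
  also have "\<dots> = (\<Sum>v\<in>J. n * mean_log_ratio v)"
    unfolding mean_log_ratio_def n_def by (subst sum.swap) simp
  also have "(\<Sum>v\<in>J. n * mean_log_ratio v) / (m * Y) + n * E \<le> (\<Sum>v\<in>J. n * \<kappa>) / (m * Y) + n * E"
    using n m Y \<kappa> by (intro add_right_mono divide_right_mono sum_mono mult_left_mono) auto
  also have "\<dots> = n * (\<kappa> / Y + E)"
    using m by (simp add: m_def[symmetric] distrib_left)
  finally have "(\<Sum>X\<in>Pow V. \<Sum>H\<in>transcripts. likelihood H (\<lambda>v. v \<in> X) * exp (- uncertainty J H (\<lambda>v. v \<in> X)))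
      \<le> n * (\<kappa> / Y + E)" .
  then show ?thesis using sum_success_le[OF J(1,2) last]
    by (simp add: n_def E_def m_def distrib_left)
qed

lemma sum_sends: "(\<Sum>v\<in>V. sends v) = T"
proof -
  have "(\<Sum>v\<in>V. sends v) = card (\<Union>v\<in>V. {t. t < T \<and> vs ! t = v})"
    unfolding sends_def by (rule card_UN_disjoint[symmetric]) (use finite_V in auto)
  also have "(\<Union>v\<in>V. {t. t < T \<and> vs ! t = v}) = {..<T}" using sender_in_V by auto
  finally show ?thesis by simp
qed

text \<open>By Markov, each of three bad properties holds for at most a quarter of the sensors:
  sending often, a large mean log ratio, and many conflicts. The last sender is dropped as well, and
  the greedy lemma is applied to the remaining sensors.\<close>

lemma ex_isolated_set:
  assumes D: "0 < D" "4 * real T \<le> real (card V) * D"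
    and \<Delta>: "0 < \<Delta>" "4 * real (card conflicts) \<le> real (card V) * \<Delta>"
    and \<kappa>: "\<kappa> = 4 * (4 * (odds \<epsilon> powr D) ^ 3 * (real T * ln 4) / card V + 2)"
    and n: "4 < card V"
  obtains J where "J \<subseteq> V" "isolated J" "last vs \<notin> J" "\<And>v. v \<in> J \<Longrightarrow> mean_log_ratio v \<le> \<kappa>"
    "real (card V) / 4 - 1 \<le> real (card J) * (\<Delta> + 1)"
proof -
  define n where "n = real (card V)"
  define M where "M = odds \<epsilon> powr D"
  define deg where "deg v = real (card {u. (u, v) \<in> conflicts})" for v
  define B1 where "B1 = {v \<in> V. D < real (sends v)}"
  \<comment> \<open>Frequent senders are removed first, because the bound on the sum of the mean log
    ratios requires \<open>odds \<epsilon> ^ sends v \<le> M\<close>.\<close>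
  define B2 where "B2 = {v \<in> V - B1. \<kappa> < mean_log_ratio v}"
  define B3 where "B3 = {v \<in> V. \<Delta> < deg v}"
  define S where "S = V - B1 - B2 - B3 - {last vs}"
  have n0: "n > 0" using n by (simp add: n_def)
  have odds: "1 \<le> odds \<epsilon>" by (rule odds_ge_1[OF \<epsilon>])
  have M: "1 \<le> M" unfolding M_def using odds D(1) by (intro ge_one_powr_ge_zero) auto
  have "real (card B1) \<le> n / 4"
    unfolding B1_def
  proof (rule card_exceeding_le[OF finite_V _ D(1)])
    show "(\<Sum>v\<in>V. real (sends v)) \<le> n / 4 * D"
      using D(2) sum_sends by (simp add: n_def flip: of_nat_sum)
  qed simp
  moreover have "real (card B2) \<le> n / 4"
    unfolding B2_def
  proof (rule card_exceeding_le)
    have "sum mean_log_ratio (V - B1) \<le> 4 * M ^ 3 * (real T * ln 4) + 2 * real (card (V - B1))"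
    proof (rule sum_mean_log_ratio[OF _ M])
      fix v assume "v \<in> V - B1"
      then have "real (sends v) \<le> D" by (simp add: B1_def not_less)
      then have "odds \<epsilon> powr real (sends v) \<le> M" unfolding M_def using odds by (rule powr_mono)
      then show "odds \<epsilon> ^ sends v \<le> M" using odds by (simp add: powr_realpow)
    qed auto
    also have "\<dots> \<le> 4 * M ^ 3 * (real T * ln 4) + 2 * n"
      using finite_V by (auto simp: n_def intro!: card_mono)
    also have "\<dots> = n / 4 * \<kappa>"
      using n0 by (simp add: \<kappa> M_def n_def[symmetric] field_simps)
    finally show "sum mean_log_ratio (V - B1) \<le> n / 4 * \<kappa>" .
    have "0 \<le> 4 * M ^ 3 * (real T * ln 4) / n" using M n0 by simp
    then have "0 < 4 * M ^ 3 * (real T * ln 4) / n + 2" by (rule add_nonneg_pos) simp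
    then show "0 < \<kappa>" unfolding \<kappa> M_def[symmetric] n_def[symmetric] by simp
  qed (use finite_V mean_log_ratio_nonneg in auto)
  moreover have "real (card B3) \<le> n / 4"
    unfolding B3_def
  proof (rule card_exceeding_le[OF finite_V _ \<Delta>(1)])
    have "conflicts = (\<Union>v\<in>V. (\<lambda>u. (u, v)) ` {u. (u, v) \<in> conflicts})"
      by (auto simp: conflicts_def)
    moreover have fin: "finite {u. (u, v) \<in> conflicts}" for v
      by (rule finite_subset[OF _ finite_V]) (auto simp: conflicts_def)
    ultimately have "card conflicts = (\<Sum>v\<in>V. card ((\<lambda>u. (u, v)) ` {u. (u, v) \<in> conflicts}))"
      using card_UN_disjoint[OF finite_V, of "\<lambda>v. (\<lambda>u. (u, v)) ` {u. (u, v) \<in> conflicts}"] by auto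
    also have "\<dots> = (\<Sum>v\<in>V. card {u. (u, v) \<in> conflicts})"
      by (intro sum.cong refl card_image) (auto simp: inj_on_def)
    finally have "(\<Sum>v\<in>V. deg v) = real (card conflicts)" by (simp add: deg_def)
    then show "sum deg V \<le> n / 4 * \<Delta>" using \<Delta>(2) by (simp add: n_def)
  qed (simp add: deg_def)
  moreover have "n \<le> real (card S) + card B1 + card B2 + card B3 + 1"
  proof -
    have "V \<subseteq> S \<union> B1 \<union> B2 \<union> B3 \<union> {last vs}" by (auto simp: S_def)
    moreover have fin: "finite (S \<union> B1 \<union> B2 \<union> B3 \<union> {last vs})"
      using finite_V by (auto simp: S_def B1_def B2_def B3_def)
    ultimately have "card V \<le> card (S \<union> B1 \<union> B2 \<union> B3 \<union> {last vs})" by (intro card_mono)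
    also have "\<dots> \<le> card S + card B1 + card B2 + card B3 + card {last vs}"
      by (intro order_trans[OF card_Un_le] add_right_mono order_refl)
    finally show ?thesis by (simp add: n_def)
  qed
  ultimately have cardS: "n / 4 - 1 \<le> real (card S)" by linarith
  have "\<exists>J\<subseteq>S. (\<forall>u\<in>J. \<forall>v\<in>J. (\<exists>w\<in>V. adj u w \<and> adj v w) \<longrightarrow> u = v) \<and>
      real (card S) \<le> real (card J) * (\<Delta> + 1)"
  proof (rule large_independent_set)
    show "finite S" using finite_V by (simp add: S_def)
    fix v assume v: "v \<in> S"
    have "card {u \<in> S. u \<noteq> v \<and> (\<exists>w\<in>V. adj u w \<and> adj v w)} \<le> card {u. (u, v) \<in> conflicts}"
      by (rule card_mono[OF finite_subset[OF _ finite_V]]) (use v in \<open>auto simp: conflicts_def S_def\<close>)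
    moreover have "deg v \<le> \<Delta>" using v by (auto simp: S_def B3_def)
    ultimately show "real (card {u \<in> S. u \<noteq> v \<and> (\<exists>w\<in>V. adj u w \<and> adj v w)}) \<le> \<Delta>"
      by (simp add: deg_def)
  qed auto
  then obtain J where J: "J \<subseteq> S" "\<forall>u\<in>J. \<forall>v\<in>J. (\<exists>w\<in>V. adj u w \<and> adj v w) \<longrightarrow> u = v"
    "real (card S) \<le> real (card J) * (\<Delta> + 1)" by blast
  show ?thesis
  proof
    show "J \<subseteq> V" "last vs \<notin> J" using J(1) by (auto simp: S_def)
    show "isolated J" using J(2) unfolding isolated_def by blast
    show "mean_log_ratio v \<le> \<kappa>" if "v \<in> J" for v
      using that J(1) by (auto simp: S_def B2_def not_less)
    show "real (card V) / 4 - 1 \<le> real (card J) * (\<Delta> + 1)"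
      using cardS J(3) by (simp add: n_def)
  qed
qed

lemma mean_success_le:
  assumes D: "0 < D" "4 * real T \<le> real (card V) * D"
    and \<Delta>: "0 < \<Delta>" "4 * real (card conflicts) \<le> real (card V) * \<Delta>"
    and \<kappa>: "4 * (4 * (odds \<epsilon> powr D) ^ 3 * (real T * ln 4) / card V + 2) \<le> \<kappa>"
    and n: "4 < card V" and vs: "vs \<noteq> []" and Y: "0 < Y"
  shows "2 * (\<Sum>X\<in>Pow V. success (\<lambda>v. v \<in> X)) \<le> 2 ^ card V *
    (1 + (\<kappa> / Y + exp (- ((real (card V) / 4 - 1) / (\<Delta> + 1) * exp (- Y)))))"
proof -
  obtain J where J: "J \<subseteq> V" "isolated J" "last vs \<notin> J"
    "\<And>v. v \<in> J \<Longrightarrow> mean_log_ratio v \<le> 4 * (4 * (odds \<epsilon> powr D) ^ 3 * (real T * ln 4) / card V + 2)"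
    "real (card V) / 4 - 1 \<le> real (card J) * (\<Delta> + 1)"
    using ex_isolated_set[OF D \<Delta> refl n] by blast
  have "J \<noteq> {}" using J(5) n by auto
  have \<kappa>': "mean_log_ratio v \<le> \<kappa>" if "v \<in> J" for v using J(4)[OF that] \<kappa> by linarith
  have "(real (card V) / 4 - 1) / (\<Delta> + 1) \<le> real (card J)"
    using J(5) \<Delta>(1) by (simp add: divide_le_eq)
  then have "(real (card V) / 4 - 1) / (\<Delta> + 1) * exp (- Y) \<le> real (card J) * exp (- Y)"
    by (intro mult_right_mono) auto
  then have "exp (- (real (card J) * exp (- Y))) \<le> exp (- ((real (card V) / 4 - 1) / (\<Delta> + 1) * exp (- Y)))"
    by simp
  then have "(2 :: real) ^ card V * (1 + (\<kappa> / Y + exp (- (real (card J) * exp (- Y))))) \<le>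
      2 ^ card V * (1 + (\<kappa> / Y + exp (- ((real (card V) / 4 - 1) / (\<Delta> + 1) * exp (- Y)))))"
    by (intro mult_left_mono add_left_mono) auto
  with sum_success_le_of_mean_log_ratio[OF J(1,2) \<open>J \<noteq> {}\<close> vs J(3) \<kappa>' Y] show ?thesis
    by linarith
qed

end

section \<open>Random planar networks\<close>

lemma prob_pair_pmf:
  "measure_pmf.prob (pair_pmf p q) {(a, b). Q a b} =
     measure_pmf.expectation p (\<lambda>a. measure_pmf.prob q {b. Q a b})"
proof -
  have "ennreal (measure_pmf.prob (pair_pmf p q) {(a, b). Q a b}) =
      (\<integral>\<^sup>+x. indicator {(a, b). Q a b} x \<partial>pair_pmf p q)"
    by (simp add: measure_pmf.emeasure_eq_measure)
  also have "\<dots> = (\<integral>\<^sup>+a. \<integral>\<^sup>+b. indicator {(a, b). Q a b} (a, b) \<partial>q \<partial>p)"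
    by (rule nn_integral_pair_pmf')
  also have "\<dots> = (\<integral>\<^sup>+a. ennreal (measure_pmf.prob q {b. Q a b}) \<partial>p)"
  proof (intro nn_integral_cong)
    fix a
    have "(\<integral>\<^sup>+b. indicator {(a, b). Q a b} (a, b) \<partial>q) = (\<integral>\<^sup>+b. indicator {b. Q a b} b \<partial>q)"
      by (intro nn_integral_cong) (simp add: indicator_def)
    then show "(\<integral>\<^sup>+b. indicator {(a, b). Q a b} (a, b) \<partial>q) = ennreal (measure_pmf.prob q {b. Q a b})"
      by (simp add: measure_pmf.emeasure_eq_measure)
  qed
  also have "\<dots> = ennreal (measure_pmf.expectation p (\<lambda>a. measure_pmf.prob q {b. Q a b}))"
    by (intro nn_integral_eq_integral measure_pmf.integrable_const_bound[where B = 1]) auto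
  finally show ?thesis
    by (simp add: integral_nonneg_AE)
qed

text \<open>Success on every input implies the same success on a uniformly random input. The bound
  for the latter holds for every fixed \<open>g\<close>, hence also after averaging over the
  internal randomness.\<close>

lemma error_protocol_bound:
  fixes V :: "'v set"
  assumes fin: "finite V" and \<epsilon>: "0 < \<epsilon>" "\<epsilon> < 1"
    and p: "error_protocol V adj \<epsilon> \<delta> (parity V) p"
    and D: "0 < D" "4 * real (cost p) \<le> real (card V) * D"
    and \<Delta>: "0 < \<Delta>"
      "4 * real (card {(u, v). u \<in> V \<and> v \<in> V \<and> u \<noteq> v \<and> (\<exists>w\<in>V. adj u w \<and> adj v w)}) \<le> real (card V) * \<Delta>"
    and \<kappa>: "4 * (4 * (odds \<epsilon> powr D) ^ 3 * (real (cost p) * ln 4) / card V + 2) \<le> \<kappa>"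
    and n: "4 < card V" and Y: "0 < Y"
  shows "1 - 2 * \<delta> \<le> \<kappa> / Y + exp (- ((real (card V) / 4 - 1) / (\<Delta> + 1) * exp (- Y)))"
proof -
  define vs where "vs = senders p"
  have vs: "vs \<noteq> []" "set vs \<subseteq> V" using p by (auto simp: error_protocol_def protocol_on_def vs_def)
  interpret P: fixed_rules V adj vs g \<epsilon> for g
    by unfold_locales (use fin \<epsilon> vs in auto)
  define B where "B = 2 ^ card V * (1 + (\<kappa> / Y + exp (- ((real (card V) / 4 - 1) / (\<Delta> + 1) * exp (- Y)))))"
  have B: "2 * (\<Sum>X\<in>Pow V. P.success g (\<lambda>v. v \<in> X)) \<le> B" for g
    unfolding B_def
    by (rule P.mean_success_le)
       (use D \<Delta> \<kappa> n Y vs in \<open>simp_all add: cost_def vs_def P.conflicts_def\<close>)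
  have cost: "cost p = length vs" by (simp add: cost_def vs_def)
  have succ: "measure_pmf.prob (noise V (cost p) \<epsilon>)
      {\<eta>. bit_sign (protocol_output adj vs g x \<eta>) = parity V x} = P.success g x" for g x
  proof -
    have "P.success g x = measure_pmf.expectation (noise V (cost p) \<epsilon>)
        (indicator {\<eta>. bit_sign (protocol_output adj vs g x \<eta>) = parity V x})"
      unfolding P.success_def noise_exp_def noise_def cost
      by (intro Bochner_Integration.integral_cong) (auto simp: indicator_def)
    then show ?thesis by simp
  qed
  have int: "integrable (measure_pmf (rules p)) (\<lambda>g. P.success g x)" for x
    unfolding succ[symmetric] by (intro measure_pmf.integrable_const_bound[where B = 1]) auto
  have "1 - \<delta> \<le> measure_pmf.expectation (rules p) (\<lambda>g. P.success g x)" for x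
    using p unfolding error_protocol_def prob_pair_pmf vs_def[symmetric] succ by blast
  then have "(\<Sum>X\<in>Pow V. 1 - \<delta>) \<le>
      (\<Sum>X\<in>Pow V. measure_pmf.expectation (rules p) (\<lambda>g. P.success g (\<lambda>v. v \<in> X)))"
    by (intro sum_mono)
  also have "\<dots> = measure_pmf.expectation (rules p) (\<lambda>g. \<Sum>X\<in>Pow V. P.success g (\<lambda>v. v \<in> X))"
    by (rule Bochner_Integration.integral_sum[symmetric]) (rule int)
  also have "\<dots> \<le> measure_pmf.expectation (rules p) (\<lambda>g. B / 2)"
  proof (intro integral_mono)
    show "(\<Sum>X\<in>Pow V. P.success g (\<lambda>v. v \<in> X)) \<le> B / 2" for g using B[of g] by simp
  qed (auto intro: int)
  finally have "2 ^ card V * (2 * (1 - \<delta>)) \<le> B" using fin by (simp add: card_Pow algebra_simps)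
  then show ?thesis unfolding B_def by simp
qed

section \<open>Dependence on the adjacency inside the vertex set only\<close>

lemma length_sent [simp]: "length (sent adj vs g x \<eta> t) = t"
  by (induction t) (simp_all add: Let_def)

lemma sent_cong:
  assumes "set vs \<subseteq> V" "\<And>u v. u \<in> V \<Longrightarrow> v \<in> V \<Longrightarrow> adj u v = adj' u v" "t \<le> length vs"
  shows "sent adj vs g x \<eta> t = sent adj' vs g x \<eta> t"
  using assms(3)
proof (induction t)
  case (Suc t)
  have "filter (\<lambda>i. adj (vs ! i) (vs ! t)) [0..<t] = filter (\<lambda>i. adj' (vs ! i) (vs ! t)) [0..<t]"
  proof (intro filter_cong refl)
    fix i assume "i \<in> set [0..<t]"
    then have "vs ! i \<in> V" "vs ! t \<in> V" using Suc.prems assms(1) by auto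
    then show "adj (vs ! i) (vs ! t) = adj' (vs ! i) (vs ! t)" by (rule assms(2))
  qed
  then show ?case using Suc by (simp add: Let_def possessed_def)
qed simp

text \<open>Needed for measurability: the success of protocols is determined by a finite graph on
  \<open>V\<close>.\<close>

lemma error_protocol_cong:
  assumes "\<And>u v. u \<in> V \<Longrightarrow> v \<in> V \<Longrightarrow> adj u v = adj' u v"
  shows "error_protocol V adj \<epsilon> \<delta> f p \<longleftrightarrow> error_protocol V adj' \<epsilon> \<delta> f p"
proof (cases "protocol_on V p")
  case True
  then have "sent adj (senders p) g x \<eta> (length (senders p)) = sent adj' (senders p) g x \<eta> (length (senders p))" for g x \<eta>
    by (intro sent_cong[of _ V] assms) (auto simp: protocol_on_def)
  then show ?thesis by (simp add: error_protocol_def protocol_output_def)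
qed (simp add: error_protocol_def)

section \<open>Close pairs among uniform random points\<close>

abbreviation unit_square :: "(real \<times> real) measure" where
  "unit_square \<equiv> uniform_measure lborel ({0..1} \<times> {0..1})"

lemma emeasure_lborel_box:
  fixes a b c d :: real
  assumes "a \<le> b" "c \<le> d"
  shows "emeasure lborel ({a..b} \<times> {c..d}) = ennreal ((b - a) * (d - c))"
proof -
  have "emeasure lborel ({a..b} \<times> {c..d}) = emeasure (lborel \<Otimes>\<^sub>M lborel) ({a..b} \<times> {c..d})"
    by (simp add: lborel_prod)
  also have "\<dots> = emeasure lborel {a..b} * emeasure lborel {c..d}"
    by (rule lborel.emeasure_pair_measure_Times) auto
  finally show ?thesis using assms by (simp add: ennreal_mult)
qed

lemma box_sets [measurable]: "{a..b} \<times> {c..d} \<in> sets (borel :: (real \<times> real) measure)"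
  by (intro borel_closed closed_Times) auto

lemma prob_space_unit_square: "prob_space unit_square"
  by (rule prob_space_uniform_measure) (simp_all add: emeasure_lborel_box)

text \<open>The disc is enclosed in a square of side 2r, which suffices and avoids computing its
  area.\<close>

lemma emeasure_unit_square_ball:
  assumes "0 \<le> r"
  shows "emeasure unit_square {q. dist p q < r} \<le> ennreal (4 * r\<^sup>2)"
proof -
  have meas: "{q. dist p q < r} \<in> sets borel" by measurable
  have sub: "{q. dist p q < r} \<subseteq> {fst p - r..fst p + r} \<times> {snd p - r..snd p + r}"
  proof
    fix q assume "q \<in> {q. dist p q < r}"
    then have "dist (fst p) (fst q) < r" "dist (snd p) (snd q) < r"
      using dist_fst_le[of p q] dist_snd_le[of p q] by auto
    then show "q \<in> {fst p - r..fst p + r} \<times> {snd p - r..snd p + r}"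
      by (cases q) (auto simp: dist_real_def abs_if split: if_splits)
  qed
  have "emeasure unit_square {q. dist p q < r} = emeasure lborel (({0..1} \<times> {0..1}) \<inter> {q. dist p q < r})"
    using meas by (subst emeasure_uniform_measure) (simp_all add: emeasure_lborel_box divide_ennreal_def)
  also have "\<dots> \<le> emeasure lborel ({fst p - r..fst p + r} \<times> {snd p - r..snd p + r})"
    using sub by (intro emeasure_mono) auto
  also have "\<dots> = ennreal (4 * r\<^sup>2)"
    using assms by (subst emeasure_lborel_box) (simp_all add: power2_eq_square)
  finally show ?thesis .
qed

lemma prob_space_random_points: "prob_space (random_points N)"
  unfolding random_points_def by (intro prob_space_PiM prob_space_unit_square)

lemma measurable_dist_random_points:
  assumes "i \<in> {1..N}" "j \<in> {1..N}"
  shows "(\<lambda>P. dist (P i) (P j)) \<in> borel_measurable (random_points N)"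
proof -
  have "(\<lambda>P. P k) \<in> measurable (random_points N) borel" if "k \<in> {1..N}" for k
    using measurable_component_singleton[OF that, of "\<lambda>_. unit_square"]
    by (simp add: random_points_def measurable_def)
  then show ?thesis using assms by (intro borel_measurable_dist)
qed

text \<open>The two points are independent. With the first point fixed, the second has to fall into
  a disc of radius r around it.\<close>

lemma prob_close_le:
  assumes ij: "i \<in> {1..N}" "j \<in> {1..N}" "i \<noteq> j" and r: "0 \<le> r"
  shows "measure (random_points N) {P \<in> space (random_points N). dist (P i) (P j) < r} \<le> 4 * r\<^sup>2"
proof -
  interpret U: prob_space unit_square by (rule prob_space_unit_square)
  interpret RP: prob_space "random_points N" by (rule prob_space_random_points)
  interpret prod: product_prob_space "\<lambda>_::nat. unit_square" "{1..N}" ..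
  let ?M = "random_points N"
  have comp: "(\<lambda>P. P k) \<in> measurable ?M unit_square" if "k \<in> {1..N}" for k
    unfolding random_points_def by (rule measurable_component_singleton[OF that])
  have pair: "(\<lambda>P. (P i, P j)) \<in> measurable ?M (unit_square \<Otimes>\<^sub>M unit_square)"
    using comp ij by (intro measurable_Pair)
  \<comment> \<open>The joint law of two distinct coordinates is identified as a product measure by
    its values on rectangles.\<close>
  have distr: "unit_square \<Otimes>\<^sub>M unit_square = distr ?M (unit_square \<Otimes>\<^sub>M unit_square) (\<lambda>P. (P i, P j))"
  proof (rule pair_measure_eqI)
    show "sigma_finite_measure unit_square" "sigma_finite_measure unit_square" by unfold_locales
    fix A B assume AB: "A \<in> sets unit_square" "B \<in> sets unit_square"
    have "emeasure (distr ?M (unit_square \<Otimes>\<^sub>M unit_square) (\<lambda>P. (P i, P j))) (A \<times> B) =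
        emeasure ?M {P \<in> space ?M. \<forall>k\<in>{i, j}. P k \<in> (if k = i then A else B)}"
      using AB ij(3) by (subst emeasure_distr[OF pair]) (auto intro!: arg_cong[of _ _ "emeasure ?M"])
    also have "\<dots> = (\<Prod>k\<in>{i, j}. emeasure unit_square (if k = i then A else B))"
      unfolding random_points_def using AB ij by (intro prod.emeasure_PiM_Collect) auto
    also have "\<dots> = emeasure unit_square A * emeasure unit_square B"
      using ij(3) by simp
    finally show "emeasure unit_square A * emeasure unit_square B =
        emeasure (distr ?M (unit_square \<Otimes>\<^sub>M unit_square) (\<lambda>P. (P i, P j))) (A \<times> B)" ..
  qed simp
  define C :: "((real \<times> real) \<times> (real \<times> real)) set" where "C = {(p, q). dist p q < r}"
  have "C \<in> sets (borel \<Otimes>\<^sub>M borel)"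
  proof -
    have "{z \<in> space (borel \<Otimes>\<^sub>M borel :: ((real \<times> real) \<times> (real \<times> real)) measure). dist (fst z) (snd z) < r} \<in> sets (borel \<Otimes>\<^sub>M borel)"
      by measurable
    moreover have "C = {z. dist (fst z) (snd z) < r}" by (auto simp: C_def)
    ultimately show ?thesis by (simp add: space_pair_measure)
  qed
  then have C: "C \<in> sets (unit_square \<Otimes>\<^sub>M unit_square)"
    by (simp cong: sets_pair_measure_cong)
  have "emeasure ?M {P \<in> space ?M. dist (P i) (P j) < r} =
      emeasure (distr ?M (unit_square \<Otimes>\<^sub>M unit_square) (\<lambda>P. (P i, P j))) C"
    by (subst emeasure_distr[OF pair C]) (auto simp: C_def intro!: arg_cong[of _ _ "emeasure ?M"])
  also have "\<dots> = emeasure (unit_square \<Otimes>\<^sub>M unit_square) C" by (simp only: distr[symmetric])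
  also have "\<dots> = (\<integral>\<^sup>+p. emeasure unit_square (Pair p -` C) \<partial>unit_square)"
    by (rule U.emeasure_pair_measure_alt[OF C])
  also have "\<dots> \<le> (\<integral>\<^sup>+p. ennreal (4 * r\<^sup>2) \<partial>unit_square)"
    using emeasure_unit_square_ball[OF r] by (intro nn_integral_mono) (simp add: C_def vimage_def)
  also have "\<dots> = ennreal (4 * r\<^sup>2)" using U.emeasure_space_1 by simp
  finally show ?thesis
    using r by (simp add: RP.emeasure_eq_measure)
qed

definition close_pairs :: "nat \<Rightarrow> real \<Rightarrow> (nat \<Rightarrow> real \<times> real) \<Rightarrow> (nat \<times> nat) set" where
  "close_pairs N r P = {(i, j). i \<in> {1..N} \<and> j \<in> {1..N} \<and> i \<noteq> j \<and> dist (P i) (P j) < r}"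

text \<open>First-moment method: Markov's inequality for the number of ordered close pairs, whose
  mean is a sum of pair probabilities.\<close>

lemma prob_many_close_pairs:
  assumes r: "0 \<le> r" and a: "0 < a"
  shows "{P \<in> space (random_points N). a \<le> real (card (close_pairs N r P))} \<in> sets (random_points N)"
    and "measure (random_points N) {P \<in> space (random_points N). a \<le> real (card (close_pairs N r P))}
      \<le> (real N)\<^sup>2 * (4 * r\<^sup>2) / a"
proof -
  interpret RP: prob_space "random_points N" by (rule prob_space_random_points)
  let ?M = "random_points N"
  define K where "K = {(i, j). i \<in> {1..N} \<and> j \<in> {1..N} \<and> i \<noteq> j}"
  define S where "S k = {P \<in> space ?M. dist (P (fst k)) (P (snd k)) < r}" for k :: "nat \<times> nat"
  have K: "K \<subseteq> {1..N} \<times> {1..N}" by (auto simp: K_def)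
  then have finK: "finite K" by (rule finite_subset) simp
  have S: "S k \<in> sets ?M" if "k \<in> K" for k
    unfolding S_def using measurable_dist_random_points[of "fst k" N "snd k"] that K
    by (intro borel_measurable_less) auto
  have eq: "real (card (close_pairs N r P)) = (\<Sum>k\<in>K. indicator (S k) P)" if "P \<in> space ?M" for P
  proof -
    have "close_pairs N r P = {k \<in> K. P \<in> S k}"
      using that by (auto simp: close_pairs_def K_def S_def)
    then show ?thesis using finK by (simp add: indicator_def sum.If_cases Int_def)
  qed
  have meas: "(\<lambda>P. \<Sum>k\<in>K. indicator (S k) P :: real) \<in> borel_measurable ?M"
    using S by (intro borel_measurable_sum borel_measurable_indicator)
  have int: "integrable ?M (indicator (S k) :: _ \<Rightarrow> real)" if "k \<in> K" for k
    using S[OF that] by (intro integrable_real_indicator) (auto simp: RP.emeasure_eq_measure)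
  have set_eq: "{P \<in> space ?M. a \<le> real (card (close_pairs N r P))} =
      {P \<in> space ?M. a \<le> (\<Sum>k\<in>K. indicator (S k) P)}"
    using eq by auto
  show "{P \<in> space ?M. a \<le> real (card (close_pairs N r P))} \<in> sets ?M"
    unfolding set_eq using meas by measurable
  have "measure ?M {P \<in> space ?M. a \<le> (\<Sum>k\<in>K. indicator (S k) P)} \<le>
      (\<integral>P. (\<Sum>k\<in>K. indicator (S k) P) \<partial>?M) / a"
    by (intro integral_Markov_inequality_measure[where A = "{}"] Bochner_Integration.integrable_sum int)
       (use a in \<open>auto intro!: sum_nonneg\<close>)
  also have "(\<integral>P. (\<Sum>k\<in>K. indicator (S k) P) \<partial>?M) = (\<Sum>k\<in>K. measure ?M (S k))"
    using int S by (subst Bochner_Integration.integral_sum) auto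
  also have "\<dots> \<le> (\<Sum>k\<in>K. 4 * r\<^sup>2)"
    unfolding S_def using prob_close_le[OF _ _ _ r] by (intro sum_mono) (auto simp: K_def)
  also have "\<dots> \<le> (real N)\<^sup>2 * (4 * r\<^sup>2)"
  proof -
    have "card K \<le> card ({1..N} \<times> {1..N})" using K by (intro card_mono) auto
    then have "real (card K) \<le> (real N)\<^sup>2" by (simp add: power2_eq_square flip: of_nat_mult)
    then show ?thesis using r by (simp add: mult_right_mono)
  qed
  finally show "measure ?M {P \<in> space ?M. a \<le> real (card (close_pairs N r P))} \<le> (real N)\<^sup>2 * (4 * r\<^sup>2) / a"
    unfolding set_eq using a by (simp add: divide_right_mono)
qed

text \<open>\<open>Q\<close> may quantify over all protocols, but it depends only on the graph on
  \<open>{1..N}\<close>. The event is a finite union over such graphs, each given by finitely many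
  distance conditions.\<close>

lemma graph_event_measurable:
  fixes Q :: "(nat \<Rightarrow> nat \<Rightarrow> bool) \<Rightarrow> bool"
  assumes cong: "\<And>adj adj'. (\<And>i j. i \<in> {1..N} \<Longrightarrow> j \<in> {1..N} \<Longrightarrow> adj i j = adj' i j) \<Longrightarrow> Q adj = Q adj'"
  shows "{P \<in> space (random_points N). Q (planar_adj r P)} \<in> sets (random_points N)"
proof -
  let ?M = "random_points N" and ?V = "{1..N} \<times> {1..N}"
  define G where "G P = {k \<in> ?V. planar_adj r P (fst k) (snd k)}" for P
  have Q: "Q (planar_adj r P) = Q (\<lambda>i j. (i, j) \<in> G P)" for P
    by (rule cong) (auto simp: G_def)
  have edge: "{P \<in> space ?M. k \<in> G P} \<in> sets ?M" if "k \<in> ?V" for k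
  proof (cases "fst k = snd k")
    case False
    have "{P \<in> space ?M. dist (P (fst k)) (P (snd k)) < r} \<in> sets ?M"
      using measurable_dist_random_points[of "fst k" N "snd k"] that
      by (intro borel_measurable_less) auto
    then show ?thesis using False that by (simp add: G_def planar_adj_def)
  qed (simp add: G_def planar_adj_def)
  have graph: "{P \<in> space ?M. G P = E} \<in> sets ?M" if "E \<subseteq> ?V" for E
  proof -
    have "{P \<in> space ?M. G P = E} = {P \<in> space ?M. \<forall>k\<in>?V. (k \<in> G P) = (k \<in> E)}"
      using that by (auto simp: G_def)
    also have "\<dots> \<in> sets ?M"
    proof (rule sets.sets_Collect_finite_All)
      fix k assume "k \<in> ?V"
      from edge[OF this] show "{P \<in> space ?M. (k \<in> G P) = (k \<in> E)} \<in> sets ?M"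
        by (cases "k \<in> E") (auto intro: sets.sets_Collect_neg)
    qed simp
    finally show ?thesis .
  qed
  have "{P \<in> space ?M. Q (planar_adj r P)} =
      (\<Union>E\<in>{E \<in> Pow ?V. Q (\<lambda>i j. (i, j) \<in> E)}. {P \<in> space ?M. G P = E})"
    unfolding Q by (auto simp: G_def)
  also have "\<dots> \<in> sets ?M"
    using graph by (intro sets.finite_UN) auto
  finally show ?thesis .
qed

section \<open>Choice of the parameters and asymptotics\<close>

lemma odds_powr_cube_le:
  assumes \<epsilon>: "0 < \<epsilon>" "\<epsilon> < 1" and c: "c = 1 / (48 * (1 + ln (odds \<epsilon>)))" and L: "0 < ln (ln x)" and x: "1 < x"
  shows "(odds \<epsilon> powr (4 * c * ln (ln x))) ^ 3 \<le> ln x powr (1 / 4)"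
proof -
  define o' where "o' = ln (odds \<epsilon>)"
  have odds: "0 < odds \<epsilon>" "0 \<le> o'" using odds_ge_1[OF \<epsilon>] by (auto simp: o'_def)
  have "(odds \<epsilon> powr (4 * c * ln (ln x))) ^ 3 = exp (12 * c * o' * ln (ln x))"
    using odds by (simp add: powr_def o'_def mult_ac flip: exp_of_nat_mult)
  \<comment> \<open>The constant 48 in \<open>c\<close> is four times the 12 in the exponent. The
    summand 1 in \<open>1 + ln (odds \<epsilon>)\<close> keeps \<open>c\<close> defined for
    \<epsilon> = 1/2, where the logarithm is 0.\<close>
  also have "12 * c * o' \<le> 1 / 4"
    using odds by (simp add: c o'_def[symmetric] field_simps)
  then have "exp (12 * c * o' * ln (ln x)) \<le> exp (1 / 4 * ln (ln x))"
    using L by (intro iffD2[OF exp_le_cancel_iff] mult_right_mono) auto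
  also have "\<dots> = ln x powr (1 / 4)" using x by (simp add: powr_def)
  finally show ?thesis .
qed

text \<open>If the cost were smaller, \<open>error_protocol_bound\<close> would apply with D = 4 c
  ln (ln N). The cube of \<open>odds \<epsilon> powr D\<close> is then at most (ln N) powr (1/4), so
  \<kappa> is of smaller order than ln N.\<close>

lemma cost_lower_bound:
  fixes V :: "'v set"
  assumes \<epsilon>: "0 < \<epsilon>" "\<epsilon> < 1" and fin: "finite V" and N: "N = real (card V)"
    and c: "c = 1 / (48 * (1 + ln (odds \<epsilon>)))"
    and p: "error_protocol V adj \<epsilon> \<delta> (parity V) p"
    and conf: "real (card {(u, v). u \<in> V \<and> v \<in> V \<and> u \<noteq> v \<and> (\<exists>w\<in>V. adj u w \<and> adj v w)}) \<le> N powr (2 - \<gamma>)"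
    and L: "0 < ln (ln N)" and n: "4 < N" and \<gamma>: "0 < \<gamma>"
    and small: "4 * (4 * ln N powr (1 / 4) * (c * ln (ln N) * ln 4) + 2) / (\<gamma> / 2 * ln N)
      + exp (- ((N / 4 - 1) / (4 * N powr (1 - \<gamma>) + 1) * N powr (- (\<gamma> / 2)))) < 1 - 2 * \<delta>"
  shows "c * N * ln (ln N) \<le> real (cost p)"
proof (rule ccontr)
  assume "\<not> ?thesis"
  then have cost: "real (cost p) \<le> c * N * ln (ln N)" by simp
  have c0: "0 < c" unfolding c using odds_ge_1[OF \<epsilon>] by (auto intro!: divide_pos_pos add_pos_nonneg)
  have N2: "N * N powr (1 - \<gamma>) = N powr (2 - \<gamma>)"
    using n powr_add[of N 1 "1 - \<gamma>"] by simp
  have "1 - 2 * \<delta> \<le> 4 * (4 * ln N powr (1 / 4) * (c * ln (ln N) * ln 4) + 2) / (\<gamma> / 2 * ln N) +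
      exp (- ((real (card V) / 4 - 1) / (4 * N powr (1 - \<gamma>) + 1) * exp (- (\<gamma> / 2 * ln N))))"
  proof (rule error_protocol_bound[OF fin \<epsilon> p])
    show "0 < 4 * c * ln (ln N)" using c0 L by simp
    show "4 * real (cost p) \<le> real (card V) * (4 * c * ln (ln N))"
      using cost by (simp add: N mult_ac)
    show "0 < 4 * N powr (1 - \<gamma>)" using n by simp
    have "4 * N powr (2 - \<gamma>) = real (card V) * (4 * N powr (1 - \<gamma>))"
      using N2 by (simp add: N)
    then show "4 * real (card {(u, v). u \<in> V \<and> v \<in> V \<and> u \<noteq> v \<and> (\<exists>w\<in>V. adj u w \<and> adj v w)})
        \<le> real (card V) * (4 * N powr (1 - \<gamma>))" using conf by linarith
    show "4 < card V" using n by (simp add: N)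
    \<comment> \<open>With this Y, \<open>exp (- Y)\<close> is N powr (- \<gamma>/2). It costs only
      half the exponent of the size of \<open>J\<close>, which is of order at least N powr \<gamma>,
      while \<kappa> / Y still tends to 0.\<close>
    show "0 < \<gamma> / 2 * ln N" using n \<gamma> by simp
    have "(odds \<epsilon> powr (4 * c * ln (ln N))) ^ 3 * (real (cost p) * ln 4) \<le>
        ln N powr (1 / 4) * (c * N * ln (ln N) * ln 4)"
      using odds_powr_cube_le[OF \<epsilon> c L] n cost by (intro mult_mono) auto
    then have "4 * (odds \<epsilon> powr (4 * c * ln (ln N))) ^ 3 * (real (cost p) * ln 4) / N \<le>
        4 * ln N powr (1 / 4) * (c * ln (ln N) * ln 4)"
      using n by (simp add: divide_le_eq mult_ac)
    then show "4 * (4 * (odds \<epsilon> powr (4 * c * ln (ln N))) ^ 3 * (real (cost p) * ln 4) / real (card V) + 2) \<le>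
        4 * (4 * ln N powr (1 / 4) * (c * ln (ln N) * ln 4) + 2)"
      by (simp add: N)
  qed
  moreover have "exp (- (\<gamma> / 2 * ln N)) = N powr (- (\<gamma> / 2))" using n by (simp add: powr_def)
  ultimately show False using small by (simp add: N)
qed

text \<open>The first summand has order (ln N) powr (1/4) * ln (ln N) / ln N; in the second, the
  argument of \<open>exp\<close> tends to minus infinity like - N powr (\<gamma>/2).\<close>

lemma eventually_small:
  fixes \<gamma> \<delta> c :: real
  assumes "0 < \<gamma>" "\<gamma> < 1" "\<delta> < 1 / 2" "0 < c"
  shows "\<forall>\<^sub>F N in sequentially. 4 * (4 * ln (real N) powr (1 / 4) * (c * ln (ln (real N)) * ln 4) + 2) / (\<gamma> / 2 * ln (real N))
      + exp (- ((real N / 4 - 1) / (4 * real N powr (1 - \<gamma>) + 1) * real N powr (- (\<gamma> / 2)))) < 1 - 2 * \<delta>"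
proof -
  have "((\<lambda>N. 4 * (4 * ln (real N) powr (1 / 4) * (c * ln (ln (real N)) * ln 4) + 2) / (\<gamma> / 2 * ln (real N))) \<longlongrightarrow> 0) sequentially"
    using assms by real_asymp
  moreover have "((\<lambda>N. exp (- ((real N / 4 - 1) / (4 * real N powr (1 - \<gamma>) + 1) * real N powr (- (\<gamma> / 2))))) \<longlongrightarrow> 0) sequentially"
    using assms by real_asymp
  ultimately have "((\<lambda>N. 4 * (4 * ln (real N) powr (1 / 4) * (c * ln (ln (real N)) * ln 4) + 2) / (\<gamma> / 2 * ln (real N))
      + exp (- ((real N / 4 - 1) / (4 * real N powr (1 - \<gamma>) + 1) * real N powr (- (\<gamma> / 2))))) \<longlongrightarrow> 0 + 0) sequentially"
    by (rule tendsto_add)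
  then show ?thesis using assms(3) by (intro order_tendstoD(2)) auto
qed

theorem theorem3:
  fixes \<beta> \<delta> \<epsilon> :: real
  assumes "\<beta> > 0" and "\<delta> < 1 / 2" and "0 < \<epsilon>" and "\<epsilon> < 1"
  shows "\<exists>c>0. \<forall>R :: nat \<Rightarrow> real. (\<forall>N\<ge>1. R N \<le> real N powr (- \<beta>)) \<longrightarrow>
    (\<lambda>N. measure (random_points N)
       {P \<in> space (random_points N).
          \<forall>p. error_protocol {1..N} (planar_adj (R N) P) \<epsilon> \<delta> (parity {1..N}) p \<longrightarrow>
            real (cost p) \<ge> c * real N * ln (ln (real N))}) \<longlonglongrightarrow> 1"
proof -
  define c where "c = 1 / (48 * (1 + ln (odds \<epsilon>)))"
  have c0: "0 < c"
    unfolding c_def using odds_ge_1[OF assms(3,4)] by (auto intro!: divide_pos_pos add_pos_nonneg)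
  \<comment> \<open>Capping at 1/2 keeps \<gamma> below 1 for large \<beta>; the bound on the radius
    only becomes weaker.\<close>
  define \<gamma> where "\<gamma> = min \<beta> (1 / 2)"
  have \<gamma>: "0 < \<gamma>" "\<gamma> < 1" "\<gamma> \<le> \<beta>" using assms(1) by (auto simp: \<gamma>_def)
  have "(\<lambda>N. measure (random_points N)
       {P \<in> space (random_points N).
          \<forall>p. error_protocol {1..N} (planar_adj (R N) P) \<epsilon> \<delta> (parity {1..N}) p \<longrightarrow>
            real (cost p) \<ge> c * real N * ln (ln (real N))}) \<longlonglongrightarrow> 1"
    if R: "\<forall>N\<ge>1. R N \<le> real N powr (- \<beta>)" for R :: "nat \<Rightarrow> real"
  proof -
    define Q where "Q N adj \<longleftrightarrow> (\<forall>p. error_protocol {1..N} adj \<epsilon> \<delta> (parity {1..N}) p \<longrightarrow>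
        real (cost p) \<ge> c * real N * ln (ln (real N)))" for N adj
    define G where "G N = {P \<in> space (random_points N). Q N (planar_adj (R N) P)}" for N
    \<comment> \<open>Two sensors with a common neighbour are at distance less than 2 * R N, by the
      triangle inequality.\<close>
    define r where "r N = 2 * real N powr (- \<gamma>)" for N
    \<comment> \<open>The bad event. The expected number of close pairs is at most 16 N powr (2 - 2
      \<gamma>), so exceeding this threshold has probability at most 16 N powr (- \<gamma>).\<close>
    define B where "B N = {P \<in> space (random_points N). real N powr (2 - \<gamma>) \<le> real (card (close_pairs N (r N) P))}" for N
    have G: "G N \<in> sets (random_points N)" for N
      unfolding G_def
    proof (rule graph_event_measurable)
      fix adj adj' :: "nat \<Rightarrow> nat \<Rightarrow> bool"
      assume "\<And>i j. i \<in> {1..N} \<Longrightarrow> j \<in> {1..N} \<Longrightarrow> adj i j = adj' i j"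
      then show "Q N adj = Q N adj'" unfolding Q_def using error_protocol_cong[of "{1..N}" adj adj'] by blast
    qed
    have "\<forall>\<^sub>F N in sequentially. 0 < ln (ln (real N))" by real_asymp
    with eventually_small[OF \<gamma>(1,2) assms(2) c0] eventually_gt_at_top[of 4]
    have lower: "\<forall>\<^sub>F N in sequentially. 1 - 16 * real N powr (- \<gamma>) \<le> measure (random_points N) (G N)"
    proof eventually_elim
      case (elim N)
      interpret RP: prob_space "random_points N" by (rule prob_space_random_points)
      have "R N \<le> real N powr (- \<gamma>)"
      proof -
        have "R N \<le> real N powr (- \<beta>)" using R elim by simp
        also have "\<dots> \<le> real N powr (- \<gamma>)" using \<gamma> elim by (intro powr_mono) auto
        finally show ?thesis .
      qed
      \<comment> \<open>Outside the bad event the lower bound is deterministic and holds for all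
        protocols simultaneously.\<close>
      have "space (random_points N) - B N \<subseteq> G N"
      proof
        fix P assume P: "P \<in> space (random_points N) - B N"
        have sub: "{(u, v). u \<in> {1..N} \<and> v \<in> {1..N} \<and> u \<noteq> v \<and>
            (\<exists>w\<in>{1..N}. planar_adj (R N) P u w \<and> planar_adj (R N) P v w)} \<subseteq> close_pairs N (r N) P"
        proof safe
          fix u v w assume *: "u \<in> {1..N}" "v \<in> {1..N}" "u \<noteq> v" "planar_adj (R N) P u w" "planar_adj (R N) P v w"
          have "dist (P u) (P v) \<le> dist (P u) (P w) + dist (P v) (P w)" by (rule dist_triangle2)
          also have "\<dots> < r N"
            using *(4,5) \<open>R N \<le> real N powr (- \<gamma>)\<close> by (simp add: planar_adj_def r_def)
          finally show "(u, v) \<in> close_pairs N (r N) P" using * by (simp add: close_pairs_def)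
        qed
        have "finite (close_pairs N (r N) P)"
          by (rule finite_subset[of _ "{1..N} \<times> {1..N}"]) (auto simp: close_pairs_def)
        from card_mono[OF this sub] have conf: "real (card {(u, v). u \<in> {1..N} \<and> v \<in> {1..N} \<and> u \<noteq> v \<and>
            (\<exists>w\<in>{1..N}. planar_adj (R N) P u w \<and> planar_adj (R N) P v w)}) \<le> real N powr (2 - \<gamma>)"
          using P by (auto simp: B_def not_le)
        have "Q N (planar_adj (R N) P)"
          unfolding Q_def
          by (intro allI impI, rule cost_lower_bound[OF assms(3,4) _ _ c_def _ conf])
             (use elim \<gamma> in auto)
        then show "P \<in> G N" using P by (simp add: G_def)
      qed
      then have "measure (random_points N) (space (random_points N) - B N) \<le> measure (random_points N) (G N)"
        using G by (intro RP.finite_measure_mono)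
      moreover have BN: "B N \<in> sets (random_points N)" "measure (random_points N) (B N)
          \<le> (real N)\<^sup>2 * (4 * (r N)\<^sup>2) / real N powr (2 - \<gamma>)"
        unfolding B_def by (rule prob_many_close_pairs; use elim in \<open>simp add: r_def\<close>)+
      moreover have "(real N)\<^sup>2 * (4 * (r N)\<^sup>2) / real N powr (2 - \<gamma>) = 16 * real N powr (- \<gamma>)"
      proof -
        have r: "(r N)\<^sup>2 = 4 * real N powr (- 2 * \<gamma>)"
          by (simp add: r_def power2_eq_square flip: powr_add)
        have "(real N)\<^sup>2 * (4 * (r N)\<^sup>2) / real N powr (2 - \<gamma>) =
            16 * (real N powr 2 * real N powr (- 2 * \<gamma>) / real N powr (2 - \<gamma>))"
          unfolding r using elim by simp
        also have "\<dots> = 16 * real N powr (- \<gamma>)"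
          unfolding powr_add[symmetric] powr_diff[symmetric] by (simp add: algebra_simps)
        finally show ?thesis .
      qed
      ultimately show ?case using RP.prob_compl[OF BN(1)] by linarith
    qed
    have "(\<lambda>N. measure (random_points N) (G N)) \<longlonglongrightarrow> 1"
    proof (rule real_tendsto_sandwich[OF lower])
      show "\<forall>\<^sub>F N in sequentially. measure (random_points N) (G N) \<le> 1"
        using prob_space.prob_le_1[OF prob_space_random_points] by simp
      show "(\<lambda>N. 1 - 16 * real N powr (- \<gamma>)) \<longlonglongrightarrow> 1" using \<gamma>(1) by real_asymp
    qed simp
    then show ?thesis unfolding G_def Q_def .
  qed
  then show ?thesis using c0 by blast
qed

end
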